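(* Let $0<a\le 1$, $b\ge 1$ with $ab>1$, and $P_1,P_2>0$. Consider the Gaussian interference channel with mixed interference $Y_1=X_1+bX_2+Z_1$, $Y_2=aX_1+X_2+Z_2$, with unit-variance Gaussian noises and input power constraints $P_1,P_2$. Let $\mathcal{R_{HK}}$ be its Han-Kobayashi region with Gaussian input and time sharing, and let $\mathcal{R_N}$ be the noiseberg region of the one-sided channel $Y_1=X_1+Z_1$, $Y_2=aX_1+X_2+Z_2$ with the same power constraints (both defined explicitly in the context). Then $\mathcal{R_N}=\mathcal{R_{HK}}$.
   Context: Channel: inputs $X_1,X_2$ are real, subject to average power constraints $P_1,P_2$; $Z_1,Z_2$ are Gaussian noises of unit variance, independent of the inputs; the channel is memoryless. Throughout $\bar\lambda=1-\lambda$, and $\log$ has a fixed base. Noiseberg region $\mathcal{R_N}$. For parameters $0\le\lambda<1$ and $h\ge 0$, put $$\frac{P_{1A}}{\bar\lambda}=P_1-\frac{P_2\lambda}{a^2\bar\lambda}-\lambda\min\Big\{h,\frac{1-a^2}{a^2}\Big\}-\max\Big\{0,h-\frac{1-a^2}{a^2}\Big\},$$ $$\frac{P_{1B}}{\lambda}=P_1+\frac{P_2}{a^2}+\bar\lambda\min\Big\{h,\frac{1-a^2}{a^2}\Big\},\qquad \frac{P_{1C}}{\bar\lambda}=\max\Big\{0,h-\frac{1-a^2}{a^2}\Big\}$$ (so $P_{1A}+P_{1B}+P_{1C}=P_1$). The pair $(\lambda,h)$ is admissible if $P_{1A}\ge 0$. $\mathcal{R_N}$ is the set of all nonnegative pairs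 $(R_1,R_2)$ for which there is an admissible $(\lambda,h)$ with $$R_1\le \bar\lambda R_{1\bar\lambda}+\lambda R_{1\lambda},\qquad R_2\le\bar\lambda R_{2\bar\lambda}$$ for some nonnegative $R_{1\bar\lambda},R_{2\bar\lambda},R_{1\lambda}$ satisfying $$R_{1\bar\lambda}\le\tfrac12\log\Big(1+\frac{P_{1A}}{\bar\lambda}\Big)+\tfrac12\log\left(1+\frac{a^2P_{1C}/\bar\lambda}{1+a^2P_{1A}/\bar\lambda+P_2/\bar\lambda}\right),$$ $$R_{2\bar\lambda}\le\tfrac12\log\left(1+\frac{P_2/\bar\lambda}{1+a^2P_{1A}/\bar\lambda}\right),\qquad R_{1\lambda}\le\tfrac12\log\Big(1+\frac{P_{1B}}{\lambda}\Big),$$ where for $\lambda=0$ the ratio $P_{1B}/\lambda$ is read as the value given by its formula and $P_{1B}=0$ (so the term $\lambda R_{1\lambda}$ vanishes). Han-Kobayashi region with Gaussian input $\mathcal{R_{HK}}$. For the mixed-interference channels with $0<a\le1$, $b\ge1$, $ab\ge1$ it is (in simplified form) the set of all nonnegative pairs $(R_1,R_2)$ for which there exist $q\in\mathbb{N}$, $q\ge1$, and for $i=1,\dots,q$ numbers $\alpha_i\in[0,1]$, $\bar\alpha_i=1-\alpha_i$, $\lambda_i\ge 0$, $P_{1i}\ge0$, $P_{2i}\ge 0$ with $\sum_i\lambda_i=1$, $\sum_i\lambda_iP_{1i}\le P_1$, $\sum_i\lambda_iP_{2i}\le P_2$, such that $$R_1\le\sum_{i=1}^q\lambda_i\,\tfrac12\log(1+P_{1i}),\qquad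 R_2\le\sum_{i=1}^q\lambda_i\,\tfrac12\log\Big(1+\frac{P_{2i}}{1+a^2\alpha_iP_{1i}}\Big),$$ $$R_1+R_2\le\sum_{i=1}^q\lambda_i\Big\{\tfrac12\log\Big(1+\frac{P_{2i}+a^2\bar\alpha_iP_{1i}}{1+a^2\alpha_iP_{1i}}\Big)+\tfrac12\log(1+\alpha_iP_{1i})\Big\}.$$ *)

theory Defs
  imports Complex_Main
begin

text \<open>
  All regions are taken with logarithms to a fixed base \<open>c\<close>. The per-band powers of the
  noiseberg scheme are primarily given by the ratios \<open>P\<^sub>1\<^sub>A/(1-\<lambda>)\<close>, \<open>P\<^sub>1\<^sub>B/\<lambda>\<close> and
  \<open>P\<^sub>1\<^sub>C/(1-\<lambda>)\<close>; this keeps \<open>P\<^sub>1\<^sub>B/\<lambda>\<close> meaningful at \<open>\<lambda> = 0\<close>.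
\<close>

definition ratio_1A :: "real \<Rightarrow> real \<Rightarrow> real \<Rightarrow> real \<Rightarrow> real \<Rightarrow> real" where
  "ratio_1A a P1 P2 lam h =
     P1 - P2 * lam / (a\<^sup>2 * (1 - lam)) - lam * min h ((1 - a\<^sup>2) / a\<^sup>2)
        - max 0 (h - (1 - a\<^sup>2) / a\<^sup>2)"

definition ratio_1B :: "real \<Rightarrow> real \<Rightarrow> real \<Rightarrow> real \<Rightarrow> real \<Rightarrow> real" where
  "ratio_1B a P1 P2 lam h = P1 + P2 / a\<^sup>2 + (1 - lam) * min h ((1 - a\<^sup>2) / a\<^sup>2)"

definition ratio_1C :: "real \<Rightarrow> real \<Rightarrow> real" where
  "ratio_1C a h = max 0 (h - (1 - a\<^sup>2) / a\<^sup>2)"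

definition power_1A :: "real \<Rightarrow> real \<Rightarrow> real \<Rightarrow> real \<Rightarrow> real \<Rightarrow> real" where
  "power_1A a P1 P2 lam h = (1 - lam) * ratio_1A a P1 P2 lam h"

definition power_1B :: "real \<Rightarrow> real \<Rightarrow> real \<Rightarrow> real \<Rightarrow> real \<Rightarrow> real" where
  "power_1B a P1 P2 lam h = lam * ratio_1B a P1 P2 lam h"

definition power_1C :: "real \<Rightarrow> real \<Rightarrow> real \<Rightarrow> real" where
  "power_1C a lam h = (1 - lam) * ratio_1C a h"

lemma power_split:
  assumes "lam \<noteq> 1"
  shows "power_1A a P1 P2 lam h + power_1B a P1 P2 lam h + power_1C a lam h = P1"
proof -
  have "(1 - lam) * (P2 * lam / (a\<^sup>2 * (1 - lam))) = lam * (P2 / a\<^sup>2)"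
    using assms by simp
  then show ?thesis
    unfolding power_1A_def power_1B_def power_1C_def ratio_1A_def ratio_1B_def ratio_1C_def
    by (simp add: algebra_simps)
qed

definition noiseberg_admissible :: "real \<Rightarrow> real \<Rightarrow> real \<Rightarrow> real \<Rightarrow> real \<Rightarrow> bool" where
  "noiseberg_admissible a P1 P2 lam h \<longleftrightarrow>
     0 \<le> lam \<and> lam < 1 \<and> 0 \<le> h \<and> 0 \<le> power_1A a P1 P2 lam h"

definition noiseberg_region :: "real \<Rightarrow> real \<Rightarrow> real \<Rightarrow> real \<Rightarrow> (real \<times> real) set" where
  "noiseberg_region c a P1 P2 =
     {(R1, R2). 0 \<le> R1 \<and> 0 \<le> R2 \<and>
       (\<exists>lam h. noiseberg_admissible a P1 P2 lam h \<and>
         (\<exists>r1 r2 s1. 0 \<le> r1 \<and> 0 \<le> r2 \<and> 0 \<le> s1 \<and>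
           R1 \<le> (1 - lam) * r1 + lam * s1 \<and>
           R2 \<le> (1 - lam) * r2 \<and>
           r1 \<le> 1/2 * log c (1 + ratio_1A a P1 P2 lam h)
                + 1/2 * log c (1 + a\<^sup>2 * ratio_1C a h
                    / (1 + a\<^sup>2 * ratio_1A a P1 P2 lam h + P2 / (1 - lam))) \<and>
           r2 \<le> 1/2 * log c (1 + (P2 / (1 - lam)) / (1 + a\<^sup>2 * ratio_1A a P1 P2 lam h)) \<and>
           s1 \<le> 1/2 * log c (1 + ratio_1B a P1 P2 lam h)))}"

text \<open>
  Han--Kobayashi region with Gaussian inputs and time sharing of the channel
  \<open>Y\<^sub>1 = X\<^sub>1 + b X\<^sub>2 + Z\<^sub>1\<close>, \<open>Y\<^sub>2 = a X\<^sub>1 + X\<^sub>2 + Z\<^sub>2\<close>, in its simplified form for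
  mixed interference (\<open>0 < a \<le> 1\<close>, \<open>b \<ge> 1\<close>, \<open>a b \<ge> 1\<close>). In this regime the gain \<open>b\<close> does
  not appear in the constraints, so it is not a parameter of the region. Time slot \<open>i\<close> has
  weight \<open>lam i\<close> and powers \<open>p1 i\<close>, \<open>p2 i\<close>; a fraction \<open>\<alpha> i\<close> of the power of user 1 is
  private, and the remaining fraction is common.
\<close>

definition mixed_HK_region :: "real \<Rightarrow> real \<Rightarrow> real \<Rightarrow> real \<Rightarrow> (real \<times> real) set" where
  "mixed_HK_region c a P1 P2 =
     {(R1, R2). 0 \<le> R1 \<and> 0 \<le> R2 \<and>
       (\<exists>(q::nat) \<alpha> lam p1 p2. 1 \<le> q \<and>
         (\<forall>i\<in>{1..q}. 0 \<le> \<alpha> i \<and> \<alpha> i \<le> 1 \<and> 0 \<le> lam i \<and> 0 \<le> p1 i \<and> 0 \<le> p2 i) \<and>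
         (\<Sum>i=1..q. lam i) = 1 \<and>
         (\<Sum>i=1..q. lam i * p1 i) \<le> P1 \<and>
         (\<Sum>i=1..q. lam i * p2 i) \<le> P2 \<and>
         R1 \<le> (\<Sum>i=1..q. lam i * (1/2 * log c (1 + p1 i))) \<and>
         R2 \<le> (\<Sum>i=1..q. lam i * (1/2 * log c (1 + p2 i / (1 + a\<^sup>2 * \<alpha> i * p1 i)))) \<and>
         R1 + R2 \<le> (\<Sum>i=1..q. lam i *
            (1/2 * log c (1 + (p2 i + a\<^sup>2 * (1 - \<alpha> i) * p1 i) / (1 + a\<^sup>2 * \<alpha> i * p1 i))
             + 1/2 * log c (1 + \<alpha> i * p1 i))))}"

end

theory Submission
  imports Defs
begin

text \<open>
  Put \<open>\<delta> = 1 - a\<^sup>2\<close> and describe a time slot with private power \<open>x\<close>, common power \<open>y\<close> of user 1 and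
  power \<open>z\<close> of user 2 by the levels \<open>u = 1 + a\<^sup>2 x\<close>, \<open>v = u + z\<close>, \<open>w = v + a\<^sup>2 y\<close> seen at receiver 2.
  Up to constants, \<open>2 (R1 + R2)\<close> is the mean of \<open>ln w + ln (u - \<delta>) - ln u\<close>, \<open>2 R2\<close> is the mean of
  \<open>ln v - ln u\<close>, and the power constraints bound the means of \<open>v - u\<close> and \<open>w\<close>. Noiseberg schemes are
  the two-slot schemes with slots \<open>A = (u, v, w\<^sub>A)\<close> and \<open>B = (w\<^sub>B, w\<^sub>B, w\<^sub>B)\<close>, where
  \<open>w\<^sub>A \<le> w\<^sub>B \<le> w\<^sub>A + \<delta>\<close> and either \<open>w\<^sub>A = v\<close> or \<open>w\<^sub>B = w\<^sub>A + \<delta>\<close>.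

  A Han-Kobayashi point is dominated by Lagrange duality: at a suitable noiseberg scheme with the same
  \<open>R2\<close> there are multipliers for which no slot beats \<open>A\<close>, while \<open>B\<close> ties with \<open>A\<close> (or has weight 0).
  For a given \<open>R2\<close>, the weight \<open>1/k\<close> of \<open>A\<close> determines the scheme, and stationarity at \<open>A\<close>
  determines the multipliers, so the tie is found by the intermediate value theorem in \<open>k\<close>.
\<close>

subsection \<open>The Lagrangian of a time slot\<close>

text \<open>As \<open>u - \<delta>\<close> is \<open>a\<^sup>2\<close> times one plus the private
  power, the first three terms are the sum rate up to a constant. \<open>\<nu>\<close> is the
  multiplier of the rate of user 2, \<open>\<beta>\<close> the price of its power and
  \<open>\<gamma>\<close> the price of the level \<open>w\<close>.\<close>

definition lagr :: "real \<Rightarrow> real \<Rightarrow> real \<Rightarrow> real \<Rightarrow> real \<Rightarrow> real \<Rightarrow> real \<Rightarrow> real" where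
  "lagr \<delta> \<nu> \<beta> \<gamma> u v w =
     ln w + ln (u - \<delta>) - ln u + \<nu> * (ln v - ln u) - \<beta> * (v - u) - \<gamma> * w"

lemma ln_le_tangent:
  fixes x y :: real
  assumes "0 < x" "0 < y"
  shows "ln x \<le> ln y + (x - y) / y"
proof -
  have "ln (x / y) \<le> x / y - 1" using assms by (intro ln_le_minus_one) auto
  then show ?thesis using assms by (simp add: ln_div diff_divide_distrib)
qed

text \<open>On the diagonal the terms in \<open>ln w\<close> cancel. What is left is concave in
  \<open>w\<close> with its maximum at \<open>w - \<delta> = 1 / \<gamma>\<close>, where the tangent
  is taken.\<close>

lemma lagr_diag_le:
  assumes "0 < \<gamma>" "\<delta> < w" "0 < w"
  shows "lagr \<delta> \<nu> \<beta> \<gamma> w w w \<le> - ln \<gamma> - 1 - \<gamma> * \<delta>"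
proof -
  have "ln (w - \<delta>) \<le> ln (1 / \<gamma>) + (w - \<delta> - 1 / \<gamma>) / (1 / \<gamma>)"
    using assms by (intro ln_le_tangent) auto
  also have "\<dots> = - ln \<gamma> + \<gamma> * w - \<gamma> * \<delta> - 1"
    using assms by (simp add: ln_div field_simps)
  finally show ?thesis by (simp add: lagr_def)
qed

text \<open>The gap is exactly \<open>\<beta> * (x - p) * (q - x) * (q - p)\<close>. Clearing the
  denominator \<open>q - p\<close> also covers \<open>p = q\<close>.\<close>

lemma quadratic_chord:
  fixes A B \<beta> p x q :: real
  assumes "p \<le> x" "x \<le> q" "0 \<le> \<beta>"
  shows "(q - p) * (A + B * x + \<beta> * x\<^sup>2)
    \<le> (x - p) * (A + B * q + \<beta> * q\<^sup>2) + (q - x) * (A + B * p + \<beta> * p\<^sup>2)"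
proof -
  have "0 \<le> \<beta> * (x - p) * (q - x) * (q - p)" using assms by simp
  then show ?thesis by (simp add: algebra_simps power2_eq_square)
qed

text \<open>\<open>\<eta>\<close> is the multiplier of \<open>v \<le> w\<close>, with complementary
  slackness \<open>slack\<close>. From \<open>v0\<close> on, the marginal gain
  \<open>\<nu> / u\<close> of the power of user 2 is at most \<open>\<beta> + \<eta>\<close>, so
  nothing is lost by removing that power and making user 1 entirely private, which gives a diagonal
  slot.\<close>

lemma lagr_beyond:
  fixes \<delta> \<nu> \<beta> \<gamma> \<eta> u v w v0 w0 :: real
  assumes "\<delta> < 1" "0 \<le> \<delta>" "0 \<le> \<nu>" "0 \<le> \<eta>" "1 \<le> v0" "v0 \<le> w0"
    and beta: "\<beta> = \<nu> / v0 - \<eta>" and gam: "\<gamma> = 1 / w0 + \<eta>" and slack: "\<eta> = 0 \<or> w0 = v0"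
    and "v0 \<le> u" "u \<le> v" "v \<le> w"
  shows "lagr \<delta> \<nu> \<beta> \<gamma> u v w \<le> - ln \<gamma> - 1 - \<gamma> * \<delta>"
proof -
  \<comment> \<open>The level of the diagonal slot. If \<open>\<eta> \<noteq> 0\<close>, it drops by
    the removed power \<open>v - u\<close>; the price saved on \<open>w\<close> then pays for the
    surplus \<open>\<eta> * (v - u)\<close> left by the next estimate.\<close>
  define z where "z = (if \<eta> = 0 then w else w - (v - u))"
  have z: "u \<le> z" using assms by (auto simp: z_def)
  have gpos: "0 < \<gamma>" unfolding gam using assms by (intro add_pos_nonneg) auto
  have "ln v - ln u \<le> (v - u) / u"
    using ln_le_tangent[of v u] assms by simp
  also have "\<dots> \<le> (v - u) / v0"
    using assms by (intro divide_left_mono) auto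
  finally have "\<nu> * (ln v - ln u) \<le> \<nu> * ((v - u) / v0)"
    using assms by (intro mult_left_mono)
  then have 1: "\<nu> * (ln v - ln u) - \<beta> * (v - u) \<le> \<eta> * (v - u)"
    unfolding beta by (simp add: algebra_simps)
  have 3: "ln w - \<gamma> * w + \<eta> * (v - u) \<le> ln z - \<gamma> * z"
  proof (cases "\<eta> = 0")
    case False
    with slack have "w0 = v0" by simp
    have diff: "w - z = v - u" using False by (simp add: z_def)
    have "ln w - ln z \<le> (w - z) / z"
      using ln_le_tangent[of w z] assms z by simp
    also have "\<dots> \<le> (w - z) / v0"
      using assms z diff by (intro divide_left_mono) auto
    also have "\<dots> = \<gamma> * (w - z) - \<eta> * (v - u)"
      unfolding gam \<open>w0 = v0\<close> diff by (simp add: algebra_simps)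
    finally show ?thesis by (simp add: algebra_simps)
  qed (simp add: z_def)
  \<comment> \<open>This is the monotonicity of \<open>(u - \<delta>) / u\<close> in
    \<open>u\<close>, cleared of denominators.\<close>
  have "(u - \<delta>) * z \<le> (z - \<delta>) * u"
    using mult_left_mono[OF z \<open>0 \<le> \<delta>\<close>] by (simp add: algebra_simps)
  then have "ln ((u - \<delta>) * z) \<le> ln ((z - \<delta>) * u)"
    using assms z by (subst ln_le_cancel_iff) auto
  then have 4: "ln (u - \<delta>) - ln u \<le> ln (z - \<delta>) - ln z"
    using assms z by (simp add: ln_mult)
  have "lagr \<delta> \<nu> \<beta> \<gamma> u v w \<le> lagr \<delta> \<nu> \<beta> \<gamma> z z z"
    using 1 3 4 by (simp add: lagr_def)
  also have "\<dots> \<le> - ln \<gamma> - 1 - \<gamma> * \<delta>"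
    using gpos assms z by (intro lagr_diag_le) auto
  finally show ?thesis .
qed

text \<open>
  Maximising over \<open>v\<close> and \<open>w\<close> leaves a function \<open>h\<close> of \<open>u\<close> whose derivative has the sign of a convex
  quadratic \<open>Q\<close>. Hence \<open>h\<close> is bounded by \<open>h u0\<close> and \<open>h v0\<close>, and the latter is bounded by the Lagrangian of
  slot \<open>B\<close>; the same bound excludes that \<open>u0\<close> is the larger root of \<open>Q\<close>.
\<close>

lemma lagr_le_crit:
  fixes \<delta> \<nu> \<beta> \<gamma> \<eta> u v w u0 v0 w0 :: real
  assumes d: "\<delta> < 1" "0 \<le> \<delta>" and mult: "0 \<le> \<nu>" "0 \<le> \<beta>" "0 \<le> \<eta>"
    and pt: "1 \<le> u0" "u0 < v0" "v0 \<le> w0"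
    and beta: "\<beta> = \<nu> / v0 - \<eta>" and gam: "\<gamma> = 1 / w0 + \<eta>" and slack: "\<eta> = 0 \<or> w0 = v0"
    and crit: "\<delta> - \<nu> * (u0 - \<delta>) + \<beta> * u0 * (u0 - \<delta>) \<le> 0"
      "u0 \<noteq> 1 \<Longrightarrow> \<delta> - \<nu> * (u0 - \<delta>) + \<beta> * u0 * (u0 - \<delta>) = 0"
    and dom: "- ln \<gamma> - 1 - \<gamma> * \<delta> \<le> lagr \<delta> \<nu> \<beta> \<gamma> u0 v0 w0"
    and uvw: "1 \<le> u" "u \<le> v" "v \<le> w"
  shows "lagr \<delta> \<nu> \<beta> \<gamma> u v w \<le> lagr \<delta> \<nu> \<beta> \<gamma> u0 v0 w0"
proof (cases "v0 \<le> u")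
  case True
  have "lagr \<delta> \<nu> \<beta> \<gamma> u v w \<le> - ln \<gamma> - 1 - \<gamma> * \<delta>"
    using d mult pt beta gam slack True uvw by (intro lagr_beyond[of \<delta> \<nu> \<eta> v0 w0 \<beta> \<gamma>]) auto
  with dom show ?thesis by simp
next
  case False
  define h where "h = (\<lambda>u. ln (u - \<delta>) - (1 + \<nu>) * ln u + \<beta> * u)"
  define Q where "Q = (\<lambda>u. \<delta> - \<nu> * (u - \<delta>) + \<beta> * u * (u - \<delta>))"
  define C where "C = \<nu> * ln v0 + ln w0 - \<beta> * v0 - \<gamma> * w0"
  have Q_alt: "Q x = (\<delta> + \<nu> * \<delta>) + (- \<nu> - \<beta> * \<delta>) * x + \<beta> * x\<^sup>2" for x
    by (simp add: Q_def algebra_simps power2_eq_square)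
  have chord: "(q - p) * Q x \<le> (x - p) * Q q + (q - x) * Q p" if "p \<le> x" "x \<le> q" for p x q
    unfolding Q_alt using that mult(2) by (rule quadratic_chord)
  have dh: "(h has_real_derivative Q x / (x * (x - \<delta>))) (at x)" if "1 \<le> x" for x
    unfolding h_def Q_def using that d
    by (auto intro!: derivative_eq_intros simp: field_simps)
  have up: "h x \<le> h y" if "1 \<le> x" "x \<le> y" "\<And>t. x \<le> t \<Longrightarrow> t \<le> y \<Longrightarrow> 0 \<le> Q t" for x y
  proof (rule DERIV_nonneg_imp_nondecreasing[OF that(2)])
    fix t assume "x \<le> t" "t \<le> y"
    then show "\<exists>z. (h has_real_derivative z) (at t) \<and> 0 \<le> z"
      using that d by (intro exI[of _ "Q t / (t * (t - \<delta>))"] conjI dh) auto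
  qed
  have down: "h y \<le> h x" if "1 \<le> x" "x \<le> y" "\<And>t. x \<le> t \<Longrightarrow> t \<le> y \<Longrightarrow> Q t \<le> 0" for x y
  proof (rule DERIV_nonpos_imp_nonincreasing[OF that(2)])
    fix t assume "x \<le> t" "t \<le> y"
    then show "\<exists>z. (h has_real_derivative z) (at t) \<and> z \<le> 0"
      using that d by (intro exI[of _ "Q t / (t * (t - \<delta>))"] conjI dh) (auto intro!: divide_nonpos_pos)
  qed
  have A: "lagr \<delta> \<nu> \<beta> \<gamma> u0 v0 w0 = C + h u0"
    by (simp add: lagr_def C_def h_def algebra_simps)
  have v0B: "C + h v0 \<le> C + h u0"
  proof -
    have "C + h v0 = lagr \<delta> \<nu> \<beta> \<gamma> v0 v0 w0" by (simp add: lagr_def C_def h_def algebra_simps)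
    also have "\<dots> \<le> - ln \<gamma> - 1 - \<gamma> * \<delta>"
      using d mult pt beta gam slack by (intro lagr_beyond[of \<delta> \<nu> \<eta> v0 w0 \<beta> \<gamma>]) auto
    finally show ?thesis using dom A by simp
  qed
  have Q0: "Q u0 \<le> 0" using crit by (simp add: Q_def)
  have "h u \<le> h u0"
  proof (cases "u0 \<le> u")
    case True
    show ?thesis
    \<comment> \<open>A convex \<open>Q\<close> that is nonpositive at \<open>u0\<close> and
      \<open>u\<close> is so in between, and \<open>h\<close> falls from \<open>u0\<close> to
      \<open>u\<close>. If \<open>Q\<close> is positive at \<open>u\<close>, it stays nonnegative up
      to \<open>v0\<close>, and \<open>h\<close> rises from \<open>u\<close> to
      \<open>v0\<close>.\<close>
    proof (cases "Q u \<le> 0")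
      case neg: True
      have "Q t \<le> 0" if "u0 \<le> t" "t \<le> u" for t
      proof (cases "u0 = u")
        case True then show ?thesis using that neg by simp
      next
        case False
        have "(u - u0) * Q t \<le> (t - u0) * Q u + (u - t) * Q u0" using that by (rule chord)
        also have "\<dots> \<le> 0" using that neg Q0
          by (intro add_nonpos_nonpos mult_nonneg_nonpos) auto
        finally show ?thesis using False \<open>u0 \<le> u\<close> by (simp add: mult_le_0_iff)
      qed
      then show ?thesis using True pt by (intro down) auto
    next
      case pos: False
      then have "u0 < u" using Q0 True by (cases "u0 = u") auto
      have "0 \<le> Q t" if "u \<le> t" "t \<le> v0" for t
      proof -
        have "(t - u0) * Q u \<le> (u - u0) * Q t + (t - u) * Q u0" using that True by (intro chord)
        moreover have "0 < (t - u0) * Q u" using pos that \<open>u0 < u\<close> by simp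
        moreover have "(t - u) * Q u0 \<le> 0" using that Q0 by (intro mult_nonneg_nonpos) auto
        ultimately have "0 < (u - u0) * Q t" by linarith
        then show ?thesis using \<open>u0 < u\<close> by (simp add: zero_less_mult_iff)
      qed
      then have "h u \<le> h v0" using uvw False by (intro up) auto
      with v0B show ?thesis by simp
    qed
  next
    case less: False
    then have "u0 \<noteq> 1" using uvw by auto
    with crit have Q00: "Q u0 = 0" by (simp add: Q_def)
    \<comment> \<open>\<open>D\<close> is the derivative of \<open>Q\<close> at its root
      \<open>u0\<close>; \<open>D > 0\<close> would make \<open>u0\<close> the larger root and let
      \<open>h\<close> rise up to \<open>v0\<close>, against \<open>v0B\<close>.\<close>
    define D where "D = \<beta> * (2 * u0 - \<delta>) - \<nu>"
    have QD: "Q t = (t - u0) * (D + \<beta> * (t - u0))" for t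
    proof -
      have "Q t - Q u0 = (t - u0) * (D + \<beta> * (t - u0))" by (simp add: Q_def D_def algebra_simps)
      then show ?thesis using Q00 by simp
    qed
    have "D \<le> 0"
    proof (rule ccontr)
      assume D: "\<not> D \<le> 0"
      \<comment> \<open>\<open>Q\<close> vanishes at \<open>u0\<close>, so strict growth is only
        claimed from the midpoint on.\<close>
      define m where "m = (u0 + v0) / 2"
      have m: "u0 < m" "m < v0" using pt by (auto simp: m_def)
      have nn: "0 \<le> Q t" if "u0 \<le> t" for t unfolding QD using that D mult by simp
      have "h u0 \<le> h m" using m pt nn by (intro up) auto
      also have "h m < h v0"
      proof (rule DERIV_pos_imp_increasing[OF m(2)])
        fix t assume t: "m \<le> t" "t \<le> v0"
        have "0 < Q t" unfolding QD using t m D mult by (intro mult_pos_pos add_pos_nonneg) auto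
        then show "\<exists>z. (h has_real_derivative z) (at t) \<and> 0 < z"
          using t m pt d by (intro exI[of _ "Q t / (t * (t - \<delta>))"] conjI dh) auto
      qed
      finally show False using v0B by simp
    qed
    have "0 \<le> Q t" if "t \<le> u0" for t
    proof -
      have "\<beta> * (t - u0) \<le> 0" using that mult by (intro mult_nonneg_nonpos) auto
      then show ?thesis unfolding QD using that \<open>D \<le> 0\<close> by (intro mult_nonpos_nonpos) auto
    qed
    then show ?thesis using less uvw by (intro up) auto
  qed
  \<comment> \<open>Tangents at \<open>v0\<close> and \<open>w0\<close> bound the terms in
    \<open>v\<close> and \<open>w\<close>. Their slopes leave a remainder that vanishes for
    \<open>\<eta> = 0\<close> and equals \<open>\<eta> * (v - w)\<close> for
    \<open>w0 = v0\<close>.\<close>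
  moreover have "lagr \<delta> \<nu> \<beta> \<gamma> u v w \<le> C + h u"
  proof -
    have "\<nu> * ln v \<le> \<nu> * (ln v0 + (v - v0) / v0)"
      using mult uvw pt by (intro mult_left_mono ln_le_tangent) auto
    moreover have "ln w \<le> ln w0 + (w - w0) / w0"
      using uvw pt by (intro ln_le_tangent) auto
    moreover have "\<nu> * ((v - v0) / v0) = (\<beta> + \<eta>) * (v - v0)"
      unfolding beta by simp
    moreover have "(w - w0) / w0 = (\<gamma> - \<eta>) * (w - w0)"
      unfolding gam by simp
    moreover have "\<eta> * (v - w) \<le> 0" using mult uvw by (intro mult_nonneg_nonpos) auto
    ultimately show ?thesis
      using slack by (auto simp: lagr_def C_def h_def algebra_simps)
  qed
  ultimately show ?thesis using A by simp
qed

subsection \<open>Existence of an optimal pair of slots\<close>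

text \<open>The right-hand side is the excess of slot \<open>A\<close> over slot \<open>B\<close> when \<open>v = w\<^sub>A = w\<^sub>B\<close>.\<close>

lemma flat_end_ineq:
  fixes \<delta> u v :: real
  assumes "0 \<le> \<delta>" "\<delta> < u" "0 < u" "u \<le> v"
  shows "0 \<le> ln (u - \<delta>) - ln u - ln (v - \<delta>) + ln v
     + \<delta> / ((u - \<delta>) * (v - \<delta>)) * ((v + u - \<delta>) * (ln v - ln u) - (v - u))"
proof -
  define q where "q = \<delta> / (u - \<delta>)"
  \<comment> \<open>For fixed \<open>u\<close> the expression vanishes at \<open>v = u\<close>. Its
    derivative in \<open>v\<close> has the sign of \<open>\<delta> * ((t - u) - u * L)\<close>,
    which the tangent bound for \<open>ln\<close> makes nonnegative.\<close>
  define f where "f = (\<lambda>v. ln (u - \<delta>) - ln u - ln (v - \<delta>) + ln v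
     + q * (((v + u - \<delta>) * (ln v - ln u) - (v - u)) / (v - \<delta>)))"
  have "f u \<le> f v"
  proof (rule DERIV_nonneg_imp_nondecreasing[OF \<open>u \<le> v\<close>])
    fix t assume t: "u \<le> t" "t \<le> v"
    define L where "L = ln t - ln u"
    define D where "D = - (1 / (t - \<delta>)) + 1 / t + q *
      (((L + (t + u - \<delta>) * (1 / t) - 1) * (t - \<delta>) - ((t + u - \<delta>) * L - (t - u))) / (t - \<delta>)\<^sup>2)"
    have "(f has_real_derivative D) (at t)"
      unfolding f_def D_def L_def using t assms
      by (auto intro!: derivative_eq_intros simp: power2_eq_square)
        (simp add: algebra_simps)
    moreover have "D = \<delta> * ((t - u) - u * L) / ((u - \<delta>) * (t - \<delta>)\<^sup>2)"
    proof -
      have nz: "t \<noteq> 0" "t - \<delta> \<noteq> 0" "u - \<delta> \<noteq> 0" using t assms by auto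
      have 1: "- (1 / (t - \<delta>)) + 1 / t = - \<delta> * (t - \<delta>) * (u - \<delta>) / (t * (u - \<delta>) * (t - \<delta>)\<^sup>2)"
        using nz by (simp add: divide_simps power2_eq_square)
      have 2: "(L + (t + u - \<delta>) * (1 / t) - 1) * (t - \<delta>) - ((t + u - \<delta>) * L - (t - u))
        = ((u - \<delta>) * (t - \<delta>) + t * ((t - u) - u * L)) / t"
        using nz by (simp add: field_simps)
      show ?thesis unfolding D_def q_def 1 2 using nz
        by (simp add: divide_simps) (simp add: algebra_simps)
    qed
    moreover have "L \<le> (t - u) / u"
      using ln_le_tangent[of t u] t assms by (simp add: L_def)
    then have "u * L \<le> t - u" using assms by (simp add: field_simps)
    ultimately show "\<exists>y. (f has_real_derivative y) (at t) \<and> 0 \<le> y"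
      using assms t by (intro exI[of _ D]) auto
  qed
  moreover have "f u = 0" using assms by (simp add: f_def)
  ultimately show ?thesis by (simp add: f_def q_def)
qed

text \<open>The least element of the compact zero set works: a negative value before it would force
  an earlier zero.\<close>

lemma first_zero:
  fixes f :: "real \<Rightarrow> real"
  assumes "a \<le> b" "continuous_on {a..b} f" "0 \<le> f a" "f b \<le> 0"
  obtains c where "a \<le> c" "c \<le> b" "f c = 0" "\<And>x. a \<le> x \<Longrightarrow> x \<le> c \<Longrightarrow> 0 \<le> f x"
proof -
  define S where "S = {x \<in> {a..b}. f x = 0}"
  have "S \<noteq> {}" using IVT2'[of f b 0 a] assms by (auto simp: S_def)
  moreover have "S = f -` {0} \<inter> {a..b}" by (auto simp: S_def)
  then have "closed S" using continuous_on_closed_vimage[of "{a..b}" f] assms(2) by simp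
  then have "compact ({a..b} \<inter> S)" by (intro compact_Int_closed) auto
  moreover have "{a..b} \<inter> S = S" by (auto simp: S_def)
  ultimately obtain c where c: "c \<in> S" "\<And>y. y \<in> S \<Longrightarrow> c \<le> y"
    using compact_attains_inf[of S] by auto
  show thesis
  proof (rule that[of c])
    show "a \<le> c" "c \<le> b" "f c = 0" using c by (auto simp: S_def)
    fix x assume x: "a \<le> x" "x \<le> c"
    show "0 \<le> f x"
    proof (rule ccontr)
      assume "\<not> 0 \<le> f x"
      moreover have "continuous_on {a..x} f"
        using assms(2) by (rule continuous_on_subset) (use x c in \<open>auto simp: S_def\<close>)
      ultimately obtain y where y: "a \<le> y" "y \<le> x" "f y = 0"
        using IVT2'[of f x 0 a] assms x by auto
      then have "y \<in> S" using x c by (auto simp: S_def)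
      then have "y = x" using c(2)[of y] y x by simp
      then show False using y \<open>\<not> 0 \<le> f x\<close> by simp
    qed
  qed
qed

text \<open>
  The level \<open>w\<^sub>B\<close> is \<open>W + min (\<delta> / k) ((W - v) / (k - 1))\<close>, the value at which the common power of slot
  \<open>A\<close> vanishes or the gap \<open>w\<^sub>B - w\<^sub>A\<close> reaches \<open>\<delta>\<close>; written with \<open>M\<close> it stays continuous at \<open>k = 1\<close>.
\<close>

lemma stationary_point:
  fixes \<delta> k u v W :: real
  assumes d: "0 \<le> \<delta>" "\<delta> < 1" and k: "1 \<le> k" and uv: "1 \<le> u" "u < v" "v \<le> W"
    and M: "M = max (k * (W - v)) (\<delta> * (k - 1))" "0 < M"
    and wB: "wB = W + \<delta> * (W - v) / M" and wA: "wA = k * W - (k - 1) * wB"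
    and gam: "\<gamma> = 1 / (wB - \<delta>)" and eta: "\<eta> = \<gamma> - 1 / wA"
    and nu: "\<nu> = v * (\<delta> / (u - \<delta>) - \<eta> * u) / (v - u)"
    and beta: "\<beta> = (\<delta> / (u - \<delta>) - \<eta> * v) / (v - u)"
  shows "v \<le> wA" "wA \<le> wB" "wB \<le> wA + \<delta>" "wA = v \<or> wB = wA + \<delta>"
    and "0 < \<gamma>" "0 \<le> \<eta>" "\<eta> = 0 \<or> wA = v" "0 \<le> \<nu>" "0 \<le> \<beta>" "\<beta> = \<nu> / v - \<eta>"
    and "\<delta> - \<nu> * (u - \<delta>) + \<beta> * u * (u - \<delta>) = 0" "\<gamma> = 1 / wA + \<eta>"
    and "lagr \<delta> \<nu>' \<beta>' \<gamma> wB wB wB = - ln \<gamma> - 1 - \<gamma> * \<delta>"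
proof -
  \<comment> \<open>\<open>r\<close> is \<open>wB - W\<close>. The two lower bounds on
    \<open>M\<close> give \<open>v \<le> wA\<close> and \<open>wB \<le> wA + \<delta>\<close>; the
    one that attains the maximum gives equality in the other constraint.\<close>
  define r where "r = \<delta> * (W - v) / M"
  have Mge: "k * (W - v) \<le> M" "\<delta> * (k - 1) \<le> M" using M by auto
  have r0: "0 \<le> r" using d uv M by (simp add: r_def)
  have wB': "wB = W + r" and wA': "wA = W - (k - 1) * r"
    using wB wA by (auto simp: r_def algebra_simps)
  have "(k - 1) * r = (\<delta> * (k - 1)) * (W - v) / M" by (simp add: r_def)
  also have "\<dots> \<le> M * (W - v) / M"
    using Mge uv M by (intro divide_right_mono mult_right_mono) auto
  finally have kr1: "(k - 1) * r \<le> W - v" using M by simp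
  then show vwA: "v \<le> wA" using wA' by simp
  have diff: "wB - wA = k * r" using wA' wB' by (simp add: algebra_simps)
  then show wAB: "wA \<le> wB" using r0 k by (simp add: algebra_simps)
  have "k * r = \<delta> * (k * (W - v)) / M" by (simp add: r_def)
  also have "\<dots> \<le> \<delta> * M / M"
    using Mge d M by (intro divide_right_mono mult_left_mono) auto
  finally have kr: "k * r \<le> \<delta>" using M by simp
  then show wBA: "wB \<le> wA + \<delta>" using diff by simp
  show alt: "wA = v \<or> wB = wA + \<delta>"
  proof (cases "M = k * (W - v)")
    case True
    then have "k * r = \<delta>" using M by (auto simp: r_def)
    then show ?thesis using diff by simp
  next
    case False
    then have "M = \<delta> * (k - 1)" using M by (auto simp: max_def split: if_splits)
    then have "(k - 1) * r = W - v" using M by (auto simp: r_def)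
    then show ?thesis using wA' by simp
  qed
  have pos: "1 < v" "1 < wA" "1 < wB" "0 < wB - \<delta>" "0 < u - \<delta>" "0 < v - u"
    using uv vwA wAB d by auto
  show "0 < \<gamma>" using pos gam by simp
  show eta0: "0 \<le> \<eta>"
  proof -
    have "1 / wA \<le> 1 / (wB - \<delta>)" using pos wBA by (intro divide_left_mono) auto
    then show ?thesis using eta gam by simp
  qed
  show etaalt: "\<eta> = 0 \<or> wA = v" using alt eta gam by auto
  \<comment> \<open>This is the sign of \<open>\<beta>\<close>. If \<open>\<eta> \<noteq> 0\<close>,
    then \<open>wA = v\<close>, and \<open>v \<le> wB\<close> bounds \<open>\<eta>\<close> by
    \<open>1 / (v - \<delta>) - 1 / v\<close>.\<close>
  have "\<eta> * v \<le> \<delta> / (u - \<delta>)"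
  proof (cases "\<eta> = 0")
    case False
    then have e: "\<eta> = 1 / (wB - \<delta>) - 1 / v" using etaalt eta gam by simp
    have "1 / (wB - \<delta>) \<le> 1 / (v - \<delta>)"
      using pos uv vwA wAB d by (intro divide_left_mono) auto
    then have "\<eta> * v \<le> (1 / (v - \<delta>) - 1 / v) * v"
      unfolding e using pos by (intro mult_right_mono) auto
    also have "\<dots> = \<delta> / (v - \<delta>)" using pos d by (simp add: field_simps)
    also have "\<dots> \<le> \<delta> / (u - \<delta>)" using pos uv d by (intro divide_left_mono) auto
    finally show ?thesis .
  qed (use pos d in auto)
  then show b0: "0 \<le> \<beta>" using beta pos by simp
  \<comment> \<open>\<open>\<nu>\<close> and \<open>\<beta>\<close> solve the linear system
    \<open>\<nu> / v = \<beta> + \<eta>\<close> (stationarity in \<open>v\<close>) and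
    \<open>\<nu> - \<beta> * u = \<delta> / (u - \<delta>)\<close> (stationarity in
    \<open>u\<close>).\<close>
  have "\<nu> / v = (\<delta> / (u - \<delta>) - \<eta> * u) / (v - u)" using pos by (simp add: nu)
  also have "\<dots> = (\<delta> / (u - \<delta>) - \<eta> * v + \<eta> * (v - u)) / (v - u)"
    by (simp add: right_diff_distrib)
  also have "\<dots> = \<beta> + \<eta>" using pos by (simp only: beta add_divide_distrib) simp
  finally show bn: "\<beta> = \<nu> / v - \<eta>" by simp
  then have "\<nu> = v * (\<beta> + \<eta>)" using pos by simp
  then show "0 \<le> \<nu>" using b0 eta0 pos by simp
  define q where "q = \<delta> / (u - \<delta>)"
  have q: "q * (u - \<delta>) = \<delta>" using pos by (simp add: q_def)
  have "\<nu> - \<beta> * u = (v * (q - \<eta> * u) - u * (q - \<eta> * v)) / (v - u)"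
    by (simp add: nu beta q_def diff_divide_distrib[symmetric] mult.commute)
  also have "v * (q - \<eta> * u) - u * (q - \<eta> * v) = q * (v - u)" by (simp add: algebra_simps)
  also have "q * (v - u) / (v - u) = q" using pos by simp
  finally have "\<nu> - \<beta> * u = q" .
  then have "(\<nu> - \<beta> * u) * (u - \<delta>) = \<delta>" using q by simp
  then show "\<delta> - \<nu> * (u - \<delta>) + \<beta> * u * (u - \<delta>) = 0" by (simp add: algebra_simps)
  show "\<gamma> = 1 / wA + \<eta>" using eta by simp
  have "\<gamma> * (wB - \<delta>) = 1" "ln \<gamma> = - ln (wB - \<delta>)" using gam pos by (auto simp: ln_div)
  then show "lagr \<delta> \<nu>' \<beta>' \<gamma> wB wB wB = - ln \<gamma> - 1 - \<gamma> * \<delta>"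
    by (simp add: lagr_def algebra_simps)
qed

text \<open>\<open>P\<close> is the power of user 2, \<open>R\<close> twice its rate in nats and
  \<open>W\<close> the mean of \<open>w\<close>. \<open>lo\<close> and \<open>hi\<close> say that
  the single slot \<open>k = 1\<close> has \<open>u \<ge> 1\<close> and \<open>v < W\<close>; from
  there \<open>k\<close> grows until the slots tie or a boundary is reached.\<close>

lemma optimal_pair_exists:
  fixes \<delta> P R W :: real
  assumes d: "0 \<le> \<delta>" "\<delta> < 1" and pos: "0 < P" "0 < R"
    and lo: "exp R - 1 \<le> P" and hi: "P * exp R < W * (exp R - 1)"
  obtains k u v wA wB \<nu> \<beta> \<gamma> where
    "1 \<le> k" "1 \<le> u" "v = u + P * k" "ln v - ln u = k * R"
    "v \<le> wA" "wA \<le> wB" "wB \<le> wA + \<delta>" "wA = v \<or> wB = wA + \<delta>"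
    "wA + (k - 1) * wB = k * W" "0 \<le> \<nu>" "0 \<le> \<beta>" "0 < \<gamma>"
    "\<And>u' v' w'. 1 \<le> u' \<Longrightarrow> u' \<le> v' \<Longrightarrow> v' \<le> w' \<Longrightarrow>
       lagr \<delta> \<nu> \<beta> \<gamma> u' v' w' \<le> lagr \<delta> \<nu> \<beta> \<gamma> u v wA"
    "k = 1 \<or> lagr \<delta> \<nu> \<beta> \<gamma> wB wB wB = lagr \<delta> \<nu> \<beta> \<gamma> u v wA"
proof -
  note result = that
  \<comment> \<open>The solution of \<open>v = u + P * k\<close> and
    \<open>ln v - ln u = k * R\<close>.\<close>
  define u where "u = (\<lambda>k. P * k / (exp (k * R) - 1))"
  define v where "v = (\<lambda>k. u k + P * k)"
  define M where "M = (\<lambda>k. max (k * (W - v k)) (\<delta> * (k - 1)))"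
  define wB where "wB = (\<lambda>k. W + \<delta> * (W - v k) / M k)"
  define wA where "wA = (\<lambda>k. k * W - (k - 1) * wB k)"
  define \<gamma> where "\<gamma> = (\<lambda>k. 1 / (wB k - \<delta>))"
  define \<eta> where "\<eta> = (\<lambda>k. \<gamma> k - 1 / wA k)"
  define \<nu> where "\<nu> = (\<lambda>k. v k * (\<delta> / (u k - \<delta>) - \<eta> k * u k) / (v k - u k))"
  define \<beta> where "\<beta> = (\<lambda>k. (\<delta> / (u k - \<delta>) - \<eta> k * v k) / (v k - u k))"
  \<comment> \<open>The subtracted term is the Lagrangian of slot \<open>B\<close>, so
    \<open>F\<close> is the excess of \<open>A\<close> over \<open>B\<close>.\<close>
  define F where "F = (\<lambda>k. lagr \<delta> (\<nu> k) (\<beta> k) (\<gamma> k) (u k) (v k) (wA k)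
      - (- ln (\<gamma> k) - 1 - \<gamma> k * \<delta>))"
  define g where "g = (\<lambda>k. min (u k - 1) (W - v k))"
  have e1: "0 < exp (k * R) - 1" if "1 \<le> k" for k using that pos by simp
  have vexp: "v k = u k * exp (k * R)" if "1 \<le> k" for k
  proof -
    define E where "E = exp (k * R)"
    have "0 < E - 1" using e1[OF that] by (simp only: E_def)
    then have "E - 1 \<noteq> 0" by linarith
    then show ?thesis unfolding v_def u_def E_def[symmetric] by (simp add: field_simps)
  qed
  have upos: "0 < u k" if "1 \<le> k" for k
    unfolding u_def using e1[OF that] pos that by (intro divide_pos_pos mult_pos_pos) auto
  have uv: "u k < v k" if "1 \<le> k" for k using pos that by (simp add: v_def)
  have lnuv: "ln (v k) - ln (u k) = k * R" if "1 \<le> k" for k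
    using upos[OF that] by (simp add: vexp[OF that] ln_mult)
  have u1: "1 \<le> u 1" using lo e1[of 1] by (simp add: u_def field_simps)
  have v1: "v 1 < W"
  proof -
    have "v 1 = P * exp R / (exp R - 1)" using vexp[of 1] by (simp add: u_def)
    also have "\<dots> < W" using hi e1[of 1] by (simp add: field_simps)
    finally show ?thesis .
  qed
  have contu: "continuous_on {1..} u"
    unfolding u_def using e1 by (intro continuous_intros) fastforce
  have contv: "continuous_on {1..} v"
    unfolding v_def by (intro continuous_intros contu)
  have Wpos: "0 < W" using v1 uv[of 1] u1 by simp
  have PW: "P < W" using v1 u1 by (simp add: v_def)
  \<comment> \<open>\<open>K\<close> is the first \<open>k\<close> at which \<open>u \<ge> 1\<close>
    or \<open>v \<le> W\<close> is tight. It exists because at \<open>k = W / P\<close> the level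
    \<open>v\<close> already exceeds \<open>W\<close>.\<close>
  obtain K where K: "1 \<le> K" "g K = 0" "\<And>k. 1 \<le> k \<Longrightarrow> k \<le> K \<Longrightarrow> 0 \<le> g k"
  proof (rule first_zero[of 1 "W / P" g])
    show "1 \<le> W / P" using PW pos by simp
    then have "g (W / P) \<le> W - v (W / P)" "0 < u (W / P)" using upos by (auto simp: g_def)
    then show "g (W / P) \<le> 0" using pos by (simp add: v_def)
    show "continuous_on {1..W / P} g" unfolding g_def
      by (intro continuous_intros continuous_on_subset[OF contu] continuous_on_subset[OF contv]) auto
    show "0 \<le> g 1" using u1 v1 by (simp add: g_def)
  qed (use that in auto)
  have range: "1 \<le> u k" "v k \<le> W" if "1 \<le> k" "k \<le> K" for k
    using K(3)[OF that] by (auto simp: g_def)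
  \<comment> \<open>For \<open>\<delta> = 0\<close> and \<open>k > 1\<close> the maximum
    \<open>M\<close> may vanish, namely when \<open>v k = W\<close>.\<close>
  have Mpos: "0 < M k" if "1 \<le> k" "k \<le> K" "k = 1 \<or> 0 < \<delta>" for k
  proof (cases "k = 1")
    case True then show ?thesis using v1 by (simp add: M_def)
  next
    case False
    then have "0 < \<delta> * (k - 1)" using that by simp
    then show ?thesis by (simp add: M_def less_max_iff_disj)
  qed
  have st: "v k \<le> wA k" "wA k \<le> wB k" "wB k \<le> wA k + \<delta>" "wA k = v k \<or> wB k = wA k + \<delta>"
    "0 < \<gamma> k" "0 \<le> \<eta> k" "\<eta> k = 0 \<or> wA k = v k" "0 \<le> \<nu> k" "0 \<le> \<beta> k" "\<beta> k = \<nu> k / v k - \<eta> k"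
    "\<delta> - \<nu> k * (u k - \<delta>) + \<beta> k * u k * (u k - \<delta>) = 0" "\<gamma> k = 1 / wA k + \<eta> k"
    "\<And>\<nu>' \<beta>'. lagr \<delta> \<nu>' \<beta>' (\<gamma> k) (wB k) (wB k) (wB k) = - ln (\<gamma> k) - 1 - \<gamma> k * \<delta>"
    if k: "1 \<le> k" "k \<le> K" "k = 1 \<or> 0 < \<delta>" for k
  proof -
    have "M k = max (k * (W - v k)) (\<delta> * (k - 1))" by (simp only: M_def)
    moreover have "wB k = W + \<delta> * (W - v k) / M k" by (simp only: wB_def)
    moreover have "wA k = k * W - (k - 1) * wB k" by (simp only: wA_def)
    moreover have "\<gamma> k = 1 / (wB k - \<delta>)" by (simp only: \<gamma>_def)
    moreover have "\<eta> k = \<gamma> k - 1 / wA k" by (simp only: \<eta>_def)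
    moreover have "\<nu> k = v k * (\<delta> / (u k - \<delta>) - \<eta> k * u k) / (v k - u k)" by (simp only: \<nu>_def)
    moreover have "\<beta> k = (\<delta> / (u k - \<delta>) - \<eta> k * v k) / (v k - u k)" by (simp only: \<beta>_def)
    ultimately have *: "M k = max (k * (W - v k)) (\<delta> * (k - 1))" "0 < M k"
      "wB k = W + \<delta> * (W - v k) / M k" "wA k = k * W - (k - 1) * wB k"
      "\<gamma> k = 1 / (wB k - \<delta>)" "\<eta> k = \<gamma> k - 1 / wA k"
      "\<nu> k = v k * (\<delta> / (u k - \<delta>) - \<eta> k * u k) / (v k - u k)"
      "\<beta> k = (\<delta> / (u k - \<delta>) - \<eta> k * v k) / (v k - u k)"
      using Mpos[OF k] by auto
    note s = stationary_point[OF d k(1) range(1)[OF k(1,2)] uv[OF k(1)] range(2)[OF k(1,2)] *]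
    show "v k \<le> wA k" "wA k \<le> wB k" "wB k \<le> wA k + \<delta>" "wA k = v k \<or> wB k = wA k + \<delta>"
      "0 < \<gamma> k" "0 \<le> \<eta> k" "\<eta> k = 0 \<or> wA k = v k" "0 \<le> \<nu> k" "0 \<le> \<beta> k" "\<beta> k = \<nu> k / v k - \<eta> k"
      "\<delta> - \<nu> k * (u k - \<delta>) + \<beta> k * u k * (u k - \<delta>) = 0" "\<gamma> k = 1 / wA k + \<eta> k"
      "\<And>\<nu>' \<beta>'. lagr \<delta> \<nu>' \<beta>' (\<gamma> k) (wB k) (wB k) (wB k) = - ln (\<gamma> k) - 1 - \<gamma> k * \<delta>"
      by (rule s)+
  qed
  txt \<open>
    At the boundary \<open>u = 1\<close> the multipliers may be raised by \<open>\<tau>\<close>, keeping \<open>\<beta> = \<nu> / v - \<eta>\<close>: the slope in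
    \<open>u\<close> only has to be nonpositive there.
  \<close>
  have finish: thesis if k: "1 \<le> k" "k \<le> K" "k = 1 \<or> 0 < \<delta>" and t: "0 \<le> \<tau>" "\<tau> = 0 \<or> u k = 1"
    and F: "0 \<le> F k + \<tau> * (ln (v k) - ln (u k) - (v k - u k) / v k)"
      "k = 1 \<or> F k + \<tau> * (ln (v k) - ln (u k) - (v k - u k) / v k) = 0" for k \<tau>
  proof -
    note s = st[OF k]
    have vk: "1 < v k" using uv[OF k(1)] range(1)[OF k(1,2)] by simp
    define \<nu>' where "\<nu>' = \<nu> k + \<tau>"
    define \<beta>' where "\<beta>' = \<beta> k + \<tau> / v k"
    \<comment> \<open>Raising by \<open>\<tau>\<close> changes the Lagrangian of \<open>A\<close> by
      \<open>\<tau>\<close> times the bracket and leaves that of \<open>B\<close> alone, where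
      \<open>v = u\<close>.\<close>
    have lA: "lagr \<delta> \<nu>' \<beta>' (\<gamma> k) (u k) (v k) (wA k)
      = F k + \<tau> * (ln (v k) - ln (u k) - (v k - u k) / v k) + (- ln (\<gamma> k) - 1 - \<gamma> k * \<delta>)"
      using vk by (simp add: F_def lagr_def \<nu>'_def \<beta>'_def diff_divide_distrib algebra_simps)
    have crit: "\<delta> - \<nu>' * (u k - \<delta>) + \<beta>' * u k * (u k - \<delta>)
      = - \<tau> * (u k - \<delta>) * (1 - u k / v k)"
      using s(11) vk by (simp add: \<nu>'_def \<beta>'_def diff_divide_distrib algebra_simps)
    have n0: "0 \<le> \<nu>'" "0 \<le> \<beta>'" using s(8,9) t vk by (auto simp: \<nu>'_def \<beta>'_def)
    have max: "lagr \<delta> \<nu>' \<beta>' (\<gamma> k) u' v' w' \<le> lagr \<delta> \<nu>' \<beta>' (\<gamma> k) (u k) (v k) (wA k)"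
      if "1 \<le> u'" "u' \<le> v'" "v' \<le> w'" for u' v' w'
    proof (rule lagr_le_crit[where \<eta> = "\<eta> k"])
      show "\<beta>' = \<nu>' / v k - \<eta> k" using s(10) by (simp add: \<nu>'_def \<beta>'_def add_divide_distrib)
      show "\<delta> - \<nu>' * (u k - \<delta>) + \<beta>' * u k * (u k - \<delta>) \<le> 0"
      proof -
        have "0 \<le> \<tau> * (u k - \<delta>) * (1 - u k / v k)"
          using t d range(1)[OF k(1,2)] uv[OF k(1)] vk by (intro mult_nonneg_nonneg) auto
        then show ?thesis unfolding crit by simp
      qed
      show "\<delta> - \<nu>' * (u k - \<delta>) + \<beta>' * u k * (u k - \<delta>) = 0" if "u k \<noteq> 1"
        using t that unfolding crit by simp
      show "- ln (\<gamma> k) - 1 - \<gamma> k * \<delta> \<le> lagr \<delta> \<nu>' \<beta>' (\<gamma> k) (u k) (v k) (wA k)"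
        unfolding lA using F by simp
    qed (use s n0 d that range(1)[OF k(1,2)] uv[OF k(1)] in auto)
    show thesis
    proof (rule result[of k "u k" "v k" "wA k" "wB k" \<nu>' \<beta>' "\<gamma> k"])
      show "v k = u k + P * k" by (simp add: v_def)
      show "wA k + (k - 1) * wB k = k * W" by (simp add: wA_def)
      show "k = 1 \<or> lagr \<delta> \<nu>' \<beta>' (\<gamma> k) (wB k) (wB k) (wB k) = lagr \<delta> \<nu>' \<beta>' (\<gamma> k) (u k) (v k) (wA k)"
        unfolding lA using s(13) F(2) by auto
    qed (use s n0 k range(1)[OF k(1,2)] lnuv[OF k(1)] max in auto)
  qed
  show thesis
  \<comment> \<open>At \<open>k = 1\<close> slot \<open>B\<close> has weight 0, so \<open>A\<close>
    only has to be at least as good and no tie is required.\<close>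
  proof (cases "0 \<le> F 1")
    case True
    then show thesis using K by (intro finish[of 1 0]) auto
  next
    case F1: False
    have dpos: "0 < \<delta>"
    proof (rule ccontr)
      assume "\<not> 0 < \<delta>"
      then have "\<delta> = 0" using d by simp
      then have "F 1 = 0" using Wpos upos[of 1]
        by (simp add: F_def lagr_def \<nu>_def \<beta>_def \<gamma>_def \<eta>_def wA_def wB_def ln_div)
      then show False using F1 by simp
    qed
    have pt: "v k \<le> wA k" "0 < wB k - \<delta>" "0 < wA k" "0 < M k" "0 < u k - \<delta>" "0 < u k" "0 < v k"
        "0 < \<gamma> k" "0 < v k - u k"
      if "k \<in> {1..K}" for k
    proof -
      have k: "1 \<le> k" "k \<le> K" using that by auto
      note s = st[OF k disjI2[OF dpos]]
      show "v k \<le> wA k" "0 < wB k - \<delta>" "0 < wA k" "0 < M k" "0 < u k - \<delta>" "0 < u k" "0 < v k"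
        "0 < \<gamma> k" "0 < v k - u k"
        using s(1,2,5) range[OF k] uv[OF k(1)] d Mpos[OF k disjI2[OF dpos]] by auto
    qed
    have nz: "wB k - \<delta> \<noteq> 0" "wA k \<noteq> 0" "M k \<noteq> 0" "u k - \<delta> \<noteq> 0" "u k \<noteq> 0" "v k \<noteq> 0" "\<gamma> k \<noteq> 0"
      "v k - u k \<noteq> 0" if "k \<in> {1..K}" for k using pt[OF that] by auto
    have cu: "continuous_on {1..K} u" and cv: "continuous_on {1..K} v"
      by (auto intro: continuous_on_subset[OF contu] continuous_on_subset[OF contv])
    have cM: "continuous_on {1..K} M" unfolding M_def by (intro continuous_intros cv)
    have cB: "continuous_on {1..K} wB" unfolding wB_def
      by (intro continuous_intros cv cM ballI nz)
    have cA: "continuous_on {1..K} wA" unfolding wA_def by (intro continuous_intros cB)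
    have cg: "continuous_on {1..K} \<gamma>" unfolding \<gamma>_def by (intro continuous_intros cB ballI nz)
    have ce: "continuous_on {1..K} \<eta>" unfolding \<eta>_def by (intro continuous_intros cA cg ballI nz)
    have cn: "continuous_on {1..K} \<nu>" unfolding \<nu>_def by (intro continuous_intros cu cv ce ballI nz)
    have cb: "continuous_on {1..K} \<beta>" unfolding \<beta>_def by (intro continuous_intros cu cv ce ballI nz)
    have cF: "continuous_on {1..K} F" unfolding F_def lagr_def
      by (intro continuous_intros cu cv cA cg cn cb ballI nz)
    show thesis
    proof (cases "0 \<le> F K")
      case True
      then obtain k where "1 \<le> k" "k \<le> K" "F k = 0"
        using IVT'[of F 1 0 K] F1 K cF by auto
      then show thesis using dpos by (intro finish[of k 0]) auto
    next
      case FK: False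
      have K1: "K \<in> {1..K}" using K by simp
      \<comment> \<open>If \<open>v K = W\<close>, the levels \<open>v\<close>, \<open>wA\<close>
        and \<open>wB\<close> coincide at \<open>K\<close>, and \<open>flat_end_ineq\<close>
        contradicts \<open>F K < 0\<close>. Hence the tight constraint at \<open>K\<close> is
        \<open>u \<ge> 1\<close>.\<close>
      have "v K \<noteq> W"
      proof
        assume vW: "v K = W"
        then have w: "wB K = v K" "wA K = v K" by (simp_all add: wB_def wA_def algebra_simps)
        define p q where "p = u K - \<delta>" and "q = v K - \<delta>"
        have pq: "0 < p" "0 < q" using pt(5)[OF K1] uv[OF K(1)] by (auto simp: p_def q_def)
        have g: "\<gamma> K = 1 / q" and e: "\<eta> K = 1 / q - 1 / v K"
          using w by (auto simp: \<gamma>_def \<eta>_def q_def)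
        have vu: "v K - u K \<noteq> 0" "v K \<noteq> 0" using pt[OF K1] by auto
        define G where "G = \<delta> / (p * q)"
        have b: "\<beta> K = G"
        proof -
          have "\<delta> / p - \<eta> K * v K = (v K - u K) * G"
            unfolding e G_def using pq vu by (simp add: field_simps) (simp add: p_def q_def algebra_simps)
          then show ?thesis using vu by (simp add: \<beta>_def p_def[symmetric])
        qed
        have n: "\<nu> K = G * (v K + u K - \<delta>)"
        proof -
          have "v K * (\<delta> / p - \<eta> K * u K) = (v K - u K) * (G * (v K + u K - \<delta>))"
            unfolding e G_def using pq vu by (simp add: field_simps) (simp add: p_def q_def algebra_simps)
          then show ?thesis using vu by (simp add: \<nu>_def p_def[symmetric])
        qed
        have "F K = ln (u K - \<delta>) - ln (u K) - ln (v K - \<delta>) + ln (v K)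
           + G * ((v K + u K - \<delta>) * (ln (v K) - ln (u K)) - (v K - u K))"
        proof -
          have "\<gamma> K * v K = 1 + \<gamma> K * \<delta>" using pq by (simp add: g field_simps) (simp add: q_def)
          moreover have "ln (\<gamma> K) = - ln (v K - \<delta>)" using pq by (simp add: g ln_div q_def)
          ultimately show ?thesis by (simp add: F_def lagr_def w n b algebra_simps)
        qed
        moreover have "0 \<le> \<dots>" unfolding G_def p_def q_def
          using pt[OF K1] d by (intro flat_end_ineq) auto
        ultimately show False using FK by simp
      qed
      then have uK: "u K = 1" using K(2) by (auto simp: g_def min_def split: if_splits)
      \<comment> \<open>\<open>T\<close> is the gain of \<open>A\<close> per unit of
        \<open>\<tau>\<close>, positive by the strict bound on \<open>ln\<close>; so
        \<open>\<tau> = - F K / T\<close> produces the tie.\<close>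
      define T where "T = ln (v K) - ln (u K) - (v K - u K) / v K"
      have "0 < T"
      proof -
        have "ln (1 / v K) \<le> 1 / v K - 1" "ln (1 / v K) \<noteq> 1 / v K - 1"
          using uv[OF K(1)] uK ln_eq_minus_one[of "1 / v K"] by (auto intro: ln_le_minus_one)
        then show ?thesis using uv[OF K(1)] uK by (simp add: T_def ln_div diff_divide_distrib)
      qed
      then have "0 \<le> - F K / T" "F K + - F K / T * T = 0" using FK by (auto simp: divide_nonpos_pos)
      then show thesis
        using K dpos uK by (intro finish[of K "- F K / T", folded T_def]) (auto simp only:)
    qed
  qed
qed

subsection \<open>The two inclusions\<close>

text \<open>The bands are read as two time slots. In the first, of weight \<open>1 - lam\<close>,
  user 1 has private power \<open>x\<close> and common power \<open>y\<close>; in the second user 1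
  is private with power \<open>w\<close> and user 2 is silent.\<close>

lemma noiseberg_subset_HK:
  fixes a P1 P2 c :: real
  assumes a: "0 < a" "a \<le> 1" and P: "0 < P1" "0 < P2" and c: "1 < c"
  shows "noiseberg_region c a P1 P2 \<subseteq> mixed_HK_region c a P1 P2"
proof safe
  fix R1 R2 assume "(R1, R2) \<in> noiseberg_region c a P1 P2"
  then obtain lam h r1 r2 s1 where R: "0 \<le> R1" "0 \<le> R2"
    and adm: "noiseberg_admissible a P1 P2 lam h"
    and r: "0 \<le> r1" "0 \<le> r2" "0 \<le> s1"
    and R1: "R1 \<le> (1 - lam) * r1 + lam * s1" and R2: "R2 \<le> (1 - lam) * r2"
    and r1: "r1 \<le> 1/2 * log c (1 + ratio_1A a P1 P2 lam h)
       + 1/2 * log c (1 + a\<^sup>2 * ratio_1C a h / (1 + a\<^sup>2 * ratio_1A a P1 P2 lam h + P2 / (1 - lam)))"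
    and r2: "r2 \<le> 1/2 * log c (1 + (P2 / (1 - lam)) / (1 + a\<^sup>2 * ratio_1A a P1 P2 lam h))"
    and s1: "s1 \<le> 1/2 * log c (1 + ratio_1B a P1 P2 lam h)"
    unfolding noiseberg_region_def by blast
  define x y z w where "x = ratio_1A a P1 P2 lam h" and "y = ratio_1C a h" and "z = P2 / (1 - lam)"
    and "w = ratio_1B a P1 P2 lam h"
  have lam: "0 \<le> lam" "lam < 1" and h: "0 \<le> h"
    using adm by (auto simp: noiseberg_admissible_def)
  have x: "0 \<le> x" using adm lam
    by (auto simp: noiseberg_admissible_def power_1A_def x_def zero_le_mult_iff)
  have y: "0 \<le> y" by (simp add: y_def ratio_1C_def)
  have z: "0 \<le> z" using P lam by (simp add: z_def)
  have asq: "0 < a\<^sup>2" "a\<^sup>2 \<le> 1" using a by (auto simp: power_le_one)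
  have w: "0 \<le> w" unfolding w_def ratio_1B_def
    using P lam h asq by (intro add_nonneg_nonneg mult_nonneg_nonneg) auto
  have power: "(1 - lam) * (x + y) + lam * w = P1"
    using power_split[of lam a P1 P2 h] lam
    by (simp add: power_1A_def power_1B_def power_1C_def x_def y_def w_def algebra_simps)
  have lc: "log c t \<le> log c s" if "0 < t" "t \<le> s" for t s using c that by simp
  define X V Y where "X = 1 + a\<^sup>2 * x" and "V = 1 + a\<^sup>2 * x + z" and "Y = a\<^sup>2 * y"
  have XV: "0 < X" "0 < V" "0 \<le> Y" using asq x y z
    by (auto simp: X_def V_def Y_def intro!: add_pos_nonneg)
  \<comment> \<open>The default 1 for zero power keeps \<open>\<alpha> * (x + y) = x\<close>
    true.\<close>
  define \<alpha> where "\<alpha> = (if x + y = 0 then 1 else x / (x + y))"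
  have \<alpha>: "0 \<le> \<alpha>" "\<alpha> \<le> 1" "\<alpha> * (x + y) = x"
    using x y by (auto simp: \<alpha>_def divide_le_eq_1)
  then have \<alpha>': "(1 - \<alpha>) * (x + y) = y" by (simp add: left_diff_distrib)
  define al ll p1 p2 where "al = (\<lambda>i::nat. if i = 1 then \<alpha> else 1)"
    and "ll = (\<lambda>i::nat. if i = 1 then 1 - lam else lam)"
    and "p1 = (\<lambda>i::nat. if i = 1 then x + y else w)"
    and "p2 = (\<lambda>i::nat. if i = 1 then z else 0)"
  have sum2: "(\<Sum>i=1..2. f i) = f 1 + f 2" for f :: "nat \<Rightarrow> real"
    by (simp add: numeral_2_eq_2)
  have pa: "a\<^sup>2 * \<alpha> * (x + y) = a\<^sup>2 * x" "a\<^sup>2 * (1 - \<alpha>) * (x + y) = Y"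
    using \<alpha>(3) \<alpha>' by (auto simp: Y_def mult.assoc)
  have B: "r1 \<le> 1/2 * log c (1 + x) + 1/2 * log c (1 + Y / V)"
    using r1 by (simp add: x_def y_def Y_def V_def z_def)
  have B2: "r2 \<le> 1/2 * log c (1 + z / X)"
    using r2 by (simp add: x_def z_def X_def)
  have S: "log c (1 + Y / V) + log c (1 + z / X) = log c (1 + (z + Y) / X)"
  proof -
    have "1 + Y / V = (V + Y) / V" "1 + z / X = V / X" "1 + (z + Y) / X = (V + Y) / X"
      using XV by (simp_all add: field_simps X_def V_def)
    then show ?thesis using c XV by (simp add: log_divide)
  qed
  \<comment> \<open>Receiver 1 sees the common part at least as well as receiver 2 does:
    \<open>a \<le> 1\<close> gives \<open>a\<^sup>2 * (1 + x) \<le> V\<close>.\<close>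
  have A: "log c (1 + x) + log c (1 + Y / V) \<le> log c (1 + (x + y))"
  proof -
    have "Y / V \<le> y / (1 + x)"
    proof -
      have "a\<^sup>2 * y * (1 + x) \<le> y * V"
      proof -
        have "a\<^sup>2 * (1 + x) \<le> V" unfolding V_def using asq z by (simp add: algebra_simps)
        then have "y * (a\<^sup>2 * (1 + x)) \<le> y * V" using y by (rule mult_left_mono)
        then show ?thesis by (simp add: mult_ac)
      qed
      then show ?thesis using XV x unfolding Y_def by (simp add: field_simps)
    qed
    then have "log c (1 + Y / V) \<le> log c (1 + y / (1 + x))"
      using XV by (intro lc add_pos_nonneg) auto
    also have "\<dots> = log c ((1 + (x + y)) / (1 + x))" using x by (simp add: field_simps)
    also have "\<dots> = log c (1 + (x + y)) - log c (1 + x)" using c x y by (simp add: log_divide)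
    finally show ?thesis by simp
  qed
  show "(R1, R2) \<in> mixed_HK_region c a P1 P2"
    unfolding mixed_HK_region_def mem_Collect_eq prod.case
  proof (intro conjI R, rule exI[of _ "2::nat"], rule exI[of _ al], rule exI[of _ ll],
      rule exI[of _ p1], rule exI[of _ p2], intro conjI)
    show "\<forall>i\<in>{1..2}. 0 \<le> al i \<and> al i \<le> 1 \<and> 0 \<le> ll i \<and> 0 \<le> p1 i \<and> 0 \<le> p2 i"
      using \<alpha> lam x y z w by (auto simp: al_def ll_def p1_def p2_def)
    show "(\<Sum>i=1..2. ll i) = 1" unfolding sum2 by (simp add: ll_def)
    show "(\<Sum>i=1..2. ll i * p1 i) \<le> P1" unfolding sum2 using power by (simp add: ll_def p1_def)
    show "(\<Sum>i=1..2. ll i * p2 i) \<le> P2" unfolding sum2 using lam by (simp add: ll_def p2_def z_def)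
    have r1': "(1 - lam) * r1 \<le> (1 - lam) * (1/2 * log c (1 + x) + 1/2 * log c (1 + Y / V))"
      using B lam by (intro mult_left_mono) auto
    have r2': "(1 - lam) * r2 \<le> (1 - lam) * (1/2 * log c (1 + z / X))"
      using B2 lam by (intro mult_left_mono) auto
    have s1': "lam * s1 \<le> lam * (1/2 * log c (1 + w))"
      using s1 lam by (intro mult_left_mono) (auto simp: w_def)
    have A': "(1 - lam) * (1/2 * log c (1 + x) + 1/2 * log c (1 + Y / V))
        \<le> (1 - lam) * (1/2 * log c (1 + (x + y)))"
      using A lam by (intro mult_left_mono) auto
    show "R1 \<le> (\<Sum>i=1..2. ll i * (1/2 * log c (1 + p1 i)))"
      unfolding sum2 using R1 r1' s1' A' by (simp add: ll_def p1_def)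
    show "R2 \<le> (\<Sum>i=1..2. ll i * (1/2 * log c (1 + p2 i / (1 + a\<^sup>2 * al i * p1 i))))"
      unfolding sum2 using R2 r2' by (simp add: ll_def p1_def p2_def al_def pa X_def)
    have "(1 - lam) * (1/2 * log c (1 + x) + 1/2 * log c (1 + Y / V)) + (1 - lam) * (1/2 * log c (1 + z / X))
       = (1 - lam) * (1/2 * log c (1 + (z + Y) / X) + 1/2 * log c (1 + x))"
      unfolding S[symmetric] by (simp add: algebra_simps)
    then show "R1 + R2 \<le> (\<Sum>i=1..2. ll i *
            (1/2 * log c (1 + (p2 i + a\<^sup>2 * (1 - al i) * p1 i) / (1 + a\<^sup>2 * al i * p1 i))
             + 1/2 * log c (1 + al i * p1 i)))"
      unfolding sum2 using R1 R2 r1' r2' s1'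
      by (simp add: ll_def p1_def p2_def al_def pa X_def \<alpha>(3))
  qed simp
qed

text \<open>This inverts the change to levels: weight \<open>1 / k\<close> means
  \<open>lam = 1 - 1 / k\<close>, and each rate is taken equal to its bound.\<close>

lemma noiseberg_regionI:
  fixes a P1 P2 c R1 R2 k u v wA wB :: real
  defines "\<delta> \<equiv> 1 - a\<^sup>2"
  assumes a: "0 < a" "a \<le> 1" and P: "0 < P1" "0 < P2" and c: "1 < c"
    and R: "0 \<le> R1" "0 \<le> R2"
    and k: "1 \<le> k" and u: "1 \<le> u" and v: "v = u + P2 * k"
    and w: "v \<le> wA" "wA \<le> wB" "wB \<le> wA + \<delta>" "wA = v \<or> wB = wA + \<delta>"
    and W: "wA + (k - 1) * wB = k * (1 + a\<^sup>2 * P1 + P2)"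
    and R2: "2 * R2 * ln c * k = ln v - ln u"
    and R12: "2 * (R1 + R2) * ln c * k \<le> ln wA + ln (u - \<delta>) - ln u + (k - 1) * ln (wB - \<delta>) - k * ln (a\<^sup>2)"
  shows "(R1, R2) \<in> noiseberg_region c a P1 P2"
proof -
  have asq: "0 < a\<^sup>2" "a\<^sup>2 \<le> 1" using a by (auto simp: power_le_one)
  have d: "0 \<le> \<delta>" "\<delta> < 1" using asq by (auto simp: \<delta>_def)
  have lc: "0 < ln c" using c by simp
  define lam where "lam = 1 - 1 / k"
  have lam: "0 \<le> lam" "lam < 1" "1 - lam = 1 / k" using k by (auto simp: lam_def)
  \<comment> \<open>By the alternative in \<open>w\<close>, cutting \<open>wB - v\<close> at
    \<open>\<delta>\<close> splits it into the gap \<open>wB - wA\<close> and the common power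
    \<open>wA - v\<close>, as \<open>min\<close> and \<open>max\<close> do in the noiseberg
    ratios.\<close>
  define h where "h = (wB - v) / a\<^sup>2"
  have "min h (\<delta> / a\<^sup>2) = min (wB - v) \<delta> / a\<^sup>2"
    using asq by (auto simp: h_def min_def divide_le_cancel)
  also have "min (wB - v) \<delta> = wB - wA" using w by (auto simp: min_def)
  finally have m: "min h ((1 - a\<^sup>2) / a\<^sup>2) = (wB - wA) / a\<^sup>2" by (simp add: \<delta>_def)
  have "max 0 (h - \<delta> / a\<^sup>2) = max 0 (wB - v - \<delta>) / a\<^sup>2"
    unfolding h_def diff_divide_distrib[symmetric]
    using asq by (auto simp: max_def zero_le_divide_iff)
  also have "max 0 (wB - v - \<delta>) = wA - v" using w by (auto simp: max_def)
  finally have C: "ratio_1C a h = (wA - v) / a\<^sup>2" by (simp add: ratio_1C_def \<delta>_def)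
  have vpos: "0 < v" "u < v" using u v P k by (auto intro: add_pos_pos)
  have "a\<^sup>2 * ratio_1A a P1 P2 lam h = u - 1"
  proof -
    have "k * (a\<^sup>2 * ratio_1A a P1 P2 lam h) = k * (u - 1)"
    proof -
      have "P2 * lam / (a\<^sup>2 * (1 - lam)) = P2 * (k - 1) / a\<^sup>2"
      proof -
        have "k * lam = k - 1" using k by (simp add: lam_def field_simps)
        then show ?thesis unfolding lam(3) by (simp add: mult_ac)
      qed
      then have "ratio_1A a P1 P2 lam h
        = P1 - P2 * (k - 1) / a\<^sup>2 - lam * (wB - wA) / a\<^sup>2 - (wA - v) / a\<^sup>2"
        using C by (simp only: ratio_1A_def ratio_1C_def m times_divide_eq_right)
      moreover have "a\<^sup>2 * (P1 - r / a\<^sup>2 - s / a\<^sup>2 - t / a\<^sup>2) = a\<^sup>2 * P1 - r - s - t" for r s t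
        using a by (simp add: right_diff_distrib)
      ultimately have A0: "a\<^sup>2 * ratio_1A a P1 P2 lam h
        = a\<^sup>2 * P1 - P2 * (k - 1) - lam * (wB - wA) - (wA - v)"
        by simp
      have "k * lam = k - 1" using k by (simp add: lam_def field_simps)
      then have "k * (a\<^sup>2 * P1 - P2 * (k - 1) - lam * (wB - wA) - (wA - v))
        = k * (a\<^sup>2 * P1 - P2 * (k - 1)) - (k - 1) * (wB - wA) - k * (wA - v)"
        by (simp add: right_diff_distrib mult.assoc[symmetric])
      also have "\<dots> = k * (u - 1)" using W v by (simp add: algebra_simps)
      finally show ?thesis unfolding A0 .
    qed
    then show ?thesis using k by simp
  qed
  then have A: "ratio_1A a P1 P2 lam h = (u - 1) / a\<^sup>2" using asq by (simp add: field_simps)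
  have B: "ratio_1B a P1 P2 lam h = (wB - 1) / a\<^sup>2"
  proof -
    have "wB - wA = k * (wB - 1 - a\<^sup>2 * P1 - P2)" using W by (simp add: algebra_simps)
    then have "(1 - lam) * ((wB - wA) / a\<^sup>2) = (wB - 1 - a\<^sup>2 * P1 - P2) / a\<^sup>2"
      using k by (simp add: lam(3))
    then show ?thesis unfolding ratio_1B_def m using a by (simp add: diff_divide_distrib)
  qed
  have A1: "1 + ratio_1A a P1 P2 lam h = (u - \<delta>) / a\<^sup>2" and B1: "1 + ratio_1B a P1 P2 lam h = (wB - \<delta>) / a\<^sup>2"
    and A2: "1 + a\<^sup>2 * ratio_1A a P1 P2 lam h = u" and Pk: "P2 / (1 - lam) = P2 * k"
    and C1: "a\<^sup>2 * ratio_1C a h = wA - v"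
    using asq k unfolding A B C lam by (auto simp: \<delta>_def field_simps)
  define r1 where "r1 = 1/2 * log c ((u - \<delta>) / a\<^sup>2) + 1/2 * log c (wA / v)"
  define r2 where "r2 = 1/2 * log c (v / u)"
  define s1 where "s1 = 1/2 * log c ((wB - \<delta>) / a\<^sup>2)"
  have quot: "1 \<le> (t - \<delta>) / a\<^sup>2" if "1 \<le> t" for t using that asq by (simp add: \<delta>_def field_simps)
  have ge1: "1 \<le> (u - \<delta>) / a\<^sup>2" "1 \<le> (wB - \<delta>) / a\<^sup>2" "1 \<le> wA / v" "1 \<le> v / u"
    using quot[of u] quot[of wB] u w vpos by auto
  have r: "0 \<le> r1" "0 \<le> r2" "0 \<le> s1"
    unfolding r1_def r2_def s1_def using ge1 c by (auto intro!: add_nonneg_nonneg)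
  have ld: "0 < u - \<delta>" "0 < wB - \<delta>" using u w vpos d by auto
  have ln1: "2 * r1 * ln c = ln (u - \<delta>) - ln (a\<^sup>2) + ln wA - ln v"
    "2 * r2 * ln c = ln v - ln u" "2 * s1 * ln c = ln (wB - \<delta>) - ln (a\<^sup>2)"
    unfolding r1_def r2_def s1_def log_def using lc ld u w vpos asq a
    by (simp_all add: field_simps ln_div)
  have R2': "R2 = (1 - lam) * r2"
  proof -
    have "(2 * ln c) * (R2 * k) = (2 * ln c) * r2" using R2 ln1(2) by (simp add: mult_ac)
    then show ?thesis using lc k unfolding lam by (simp add: field_simps)
  qed
  have R1': "R1 \<le> (1 - lam) * r1 + lam * s1"
  proof -
    have "(2 * ln c) * (R1 * k) \<le> (2 * ln c) * (r1 + (k - 1) * s1)"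
    proof -
      have "(2 * ln c) * (R1 * k) = 2 * (R1 + R2) * ln c * k - 2 * R2 * ln c * k"
        by (simp add: algebra_simps)
      also have "\<dots> \<le> (ln (u - \<delta>) - ln (a\<^sup>2) + ln wA - ln v) + (k - 1) * (ln (wB - \<delta>) - ln (a\<^sup>2))"
        using R12 R2 by (simp add: algebra_simps)
      also have "\<dots> = (2 * ln c) * (r1 + (k - 1) * s1)"
        unfolding ln1[symmetric] by (simp add: algebra_simps)
      finally show ?thesis .
    qed
    then have "R1 * k \<le> r1 + (k - 1) * s1" using lc by simp
    then show ?thesis using k by (simp add: lam_def field_simps)
  qed
  have C2: "1 + (wA - v) / v = wA / v" "1 + P2 * k / u = v / u"
    using vpos u v by (auto simp: field_simps)
  have adm: "noiseberg_admissible a P1 P2 lam h"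
    unfolding noiseberg_admissible_def power_1A_def A
    using lam(1,2) u asq w by (auto simp: h_def)
  show ?thesis
    unfolding noiseberg_region_def mem_Collect_eq prod.case
    by (intro conjI R, rule exI[of _ lam], rule exI[of _ h], rule conjI[OF adm],
        rule exI[of _ r1], rule exI[of _ r2], rule exI[of _ s1])
      (use r R1' R2' in \<open>simp add: A1 A2 B1 Pk C1 v[symmetric] C2 r1_def r2_def s1_def\<close>)
qed

text \<open>Jensen's inequality, with the tangent taken at the bound \<open>P\<close> rather than at
  the mean, so that a smaller mean is covered at once.\<close>

lemma sum_ln_le_ln_mean:
  fixes l x :: "nat \<Rightarrow> real" and P :: real
  assumes l: "\<And>i. i \<in> I \<Longrightarrow> 0 \<le> l i" "sum l I = 1"
    and x: "\<And>i. i \<in> I \<Longrightarrow> 0 \<le> x i" and P: "(\<Sum>i\<in>I. l i * x i) \<le> P" "0 < P"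
  shows "(\<Sum>i\<in>I. l i * ln (1 + x i)) \<le> ln (1 + P)"
proof -
  have "(\<Sum>i\<in>I. l i * ln (1 + x i)) \<le> (\<Sum>i\<in>I. l i * (ln (1 + P) + ((1 + x i) - (1 + P)) / (1 + P)))"
    using l x P by (intro sum_mono mult_left_mono ln_le_tangent) (auto intro!: add_pos_nonneg)
  also have "\<dots> = (\<Sum>i\<in>I. l i * ln (1 + P) + (l i * x i - l i * P) / (1 + P))"
    by (simp add: algebra_simps)
  also have "\<dots> = ln (1 + P) + ((\<Sum>i\<in>I. l i * x i) - P) / (1 + P)"
    using l(2) by (simp add: sum.distrib sum_subtractf sum_divide_distrib[symmetric] sum_distrib_right[symmetric])
  also have "\<dots> \<le> ln (1 + P)" using P by (simp add: divide_nonpos_pos)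
  finally show ?thesis .
qed

text \<open>A small rate of user 2 is served by \<open>lam = 0\<close> and \<open>h = 0\<close>.
  Otherwise the pair of \<open>optimal_pair_exists\<close> meets the rate exactly, and its
  multipliers bound the sum rate of every Han-Kobayashi scheme.\<close>

lemma HK_subset_noiseberg:
  fixes a P1 P2 c :: real
  assumes a: "0 < a" "a \<le> 1" and P: "0 < P1" "0 < P2" and c: "1 < c"
  shows "mixed_HK_region c a P1 P2 \<subseteq> noiseberg_region c a P1 P2"
proof safe
  fix R1 R2 assume "(R1, R2) \<in> mixed_HK_region c a P1 P2"
  then obtain q :: nat and \<alpha> l p1 p2 where R: "0 \<le> R1" "0 \<le> R2"
    and nn: "\<And>i. i \<in> {1..q} \<Longrightarrow> 0 \<le> \<alpha> i \<and> \<alpha> i \<le> 1 \<and> 0 \<le> l i \<and> 0 \<le> p1 i \<and> 0 \<le> p2 i"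
    and l1: "(\<Sum>i=1..q. l i) = 1" and s1: "(\<Sum>i=1..q. l i * p1 i) \<le> P1"
    and s2: "(\<Sum>i=1..q. l i * p2 i) \<le> P2"
    and R1: "R1 \<le> (\<Sum>i=1..q. l i * (1/2 * log c (1 + p1 i)))"
    and R2: "R2 \<le> (\<Sum>i=1..q. l i * (1/2 * log c (1 + p2 i / (1 + a\<^sup>2 * \<alpha> i * p1 i))))"
    and R12: "R1 + R2 \<le> (\<Sum>i=1..q. l i *
            (1/2 * log c (1 + (p2 i + a\<^sup>2 * (1 - \<alpha> i) * p1 i) / (1 + a\<^sup>2 * \<alpha> i * p1 i))
             + 1/2 * log c (1 + \<alpha> i * p1 i)))"
    unfolding mixed_HK_region_def by blast
  have asq: "0 < a\<^sup>2" "a\<^sup>2 \<le> 1" using a by (auto simp: power_le_one)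
  have lc: "0 < ln c" using c by simp
  define \<delta> where "\<delta> = 1 - a\<^sup>2"
  have d: "0 \<le> \<delta>" "\<delta> < 1" using asq by (auto simp: \<delta>_def)
  define W where "W = 1 + a\<^sup>2 * P1 + P2"
  define u where "u = (\<lambda>i. 1 + a\<^sup>2 * \<alpha> i * p1 i)"
  define v where "v = (\<lambda>i. u i + p2 i)"
  define w where "w = (\<lambda>i. v i + a\<^sup>2 * (1 - \<alpha> i) * p1 i)"
  have uvw: "1 \<le> u i" "u i \<le> v i" "v i \<le> w i" "0 < u i - \<delta>" if "i \<in> {1..q}" for i
  proof -
    show "1 \<le> u i" "u i \<le> v i" "v i \<le> w i"
      using nn[OF that] asq by (auto simp: u_def v_def w_def)
    then show "0 < u i - \<delta>" using d by simp
  qed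
  have u_eq: "1 + a\<^sup>2 * \<alpha> i * p1 i = u i" for i by (simp add: u_def)
  have R2l: "2 * R2 * ln c \<le> (\<Sum>i=1..q. l i * (ln (v i) - ln (u i)))"
  proof -
    have "2 * R2 * ln c \<le> 2 * (\<Sum>i=1..q. l i * (1/2 * log c (1 + p2 i / (1 + a\<^sup>2 * \<alpha> i * p1 i)))) * ln c"
      using R2 lc by simp
    also have "\<dots> = (\<Sum>i=1..q. l i * (ln (v i) - ln (u i)))"
      unfolding sum_distrib_left sum_distrib_right
    proof (intro sum.cong refl)
      fix i assume i: "i \<in> {1..q}"
      have "1 + p2 i / (1 + a\<^sup>2 * \<alpha> i * p1 i) = v i / u i"
        unfolding u_eq using uvw[OF i] by (simp add: v_def field_simps)
      then show "2 * (l i * (1/2 * log c (1 + p2 i / (1 + a\<^sup>2 * \<alpha> i * p1 i)))) * ln c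
        = l i * (ln (v i) - ln (u i))"
        using uvw[OF i] lc by (simp add: log_def ln_div)
    qed
    finally show ?thesis .
  qed
  have R12l: "2 * (R1 + R2) * ln c \<le> (\<Sum>i=1..q. l i * (ln (w i) + ln (u i - \<delta>) - ln (u i))) - ln (a\<^sup>2)"
  proof -
    have "2 * (R1 + R2) * ln c \<le> 2 * (\<Sum>i=1..q. l i *
            (1/2 * log c (1 + (p2 i + a\<^sup>2 * (1 - \<alpha> i) * p1 i) / (1 + a\<^sup>2 * \<alpha> i * p1 i))
             + 1/2 * log c (1 + \<alpha> i * p1 i))) * ln c"
      using R12 lc by simp
    also have "\<dots> = (\<Sum>i=1..q. l i * (ln (w i) + ln (u i - \<delta>) - ln (u i)) - l i * ln (a\<^sup>2))"
      unfolding sum_distrib_left sum_distrib_right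
    proof (intro sum.cong refl)
      fix i assume i: "i \<in> {1..q}"
      have 1: "1 + (p2 i + a\<^sup>2 * (1 - \<alpha> i) * p1 i) / (1 + a\<^sup>2 * \<alpha> i * p1 i) = w i / u i"
        unfolding u_eq using uvw[OF i] by (simp add: v_def w_def field_simps)
      have 2: "1 + \<alpha> i * p1 i = (u i - \<delta>) / a\<^sup>2"
        using asq by (simp add: u_def \<delta>_def field_simps)
      show "2 * (l i * (1/2 * log c (1 + (p2 i + a\<^sup>2 * (1 - \<alpha> i) * p1 i) / (1 + a\<^sup>2 * \<alpha> i * p1 i))
             + 1/2 * log c (1 + \<alpha> i * p1 i))) * ln c
        = l i * (ln (w i) + ln (u i - \<delta>) - ln (u i)) - l i * ln (a\<^sup>2)"
        unfolding 1 2 log_def using uvw[OF i] lc asq a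
        by (simp add: ln_div field_simps)
    qed
    also have "\<dots> = (\<Sum>i=1..q. l i * (ln (w i) + ln (u i - \<delta>) - ln (u i))) - ln (a\<^sup>2)"
      using l1 by (simp add: sum_subtractf sum_distrib_right[symmetric])
    finally show ?thesis .
  qed
  have costz: "(\<Sum>i=1..q. l i * (v i - u i)) \<le> P2" using s2 by (simp add: v_def)
  have costw: "(\<Sum>i=1..q. l i * w i) \<le> W"
  proof -
    have "(\<Sum>i=1..q. l i * w i) = (\<Sum>i=1..q. l i + a\<^sup>2 * (l i * p1 i) + l i * p2 i)"
      by (intro sum.cong) (auto simp: w_def v_def u_def algebra_simps)
    also have "\<dots> = 1 + a\<^sup>2 * (\<Sum>i=1..q. l i * p1 i) + (\<Sum>i=1..q. l i * p2 i)"
      using l1 by (simp add: sum.distrib sum_distrib_left)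
    also have "\<dots> \<le> W" unfolding W_def using s1 s2 asq by (intro add_mono mult_left_mono) auto
    finally show ?thesis .
  qed
  define R where "R = 2 * R2 * ln c"
  have Wpos: "0 < W - P2" "0 < W" using asq P by (auto simp: W_def add_pos_nonneg)
  show "(R1, R2) \<in> noiseberg_region c a P1 P2"
  \<comment> \<open>The threshold is twice the rate, in nats, that user 2 attains when user 1 sends
    all of \<open>P1\<close> privately.\<close>
  proof (cases "R \<le> ln (W / (W - P2))")
    case True
    have "2 * R1 * ln c \<le> 2 * (\<Sum>i=1..q. l i * (1/2 * log c (1 + p1 i))) * ln c"
      using R1 lc by simp
    also have "\<dots> = (\<Sum>i=1..q. l i * ln (1 + p1 i))"
      unfolding sum_distrib_left sum_distrib_right using lc by (simp add: log_def)
    also have "\<dots> \<le> ln (1 + P1)" using nn l1 s1 P by (intro sum_ln_le_ln_mean) auto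
    finally have b1: "R1 \<le> 1/2 * log c (1 + P1)" using lc by (simp add: log_def field_simps)
    have b2: "R2 \<le> 1/2 * log c (1 + P2 / (1 + a\<^sup>2 * P1))"
    proof -
      have "W / (W - P2) = 1 + P2 / (1 + a\<^sup>2 * P1)" using Wpos by (simp add: W_def field_simps)
      then show ?thesis using True lc by (simp add: R_def log_def field_simps)
    qed
    have r: "ratio_1A a P1 P2 0 0 = P1" "ratio_1C a 0 = 0" "0 \<le> ratio_1B a P1 P2 0 0"
    proof -
      have "0 \<le> (1 - a\<^sup>2) / a\<^sup>2" using asq by simp
      then show "ratio_1A a P1 P2 0 0 = P1" "ratio_1C a 0 = 0" "0 \<le> ratio_1B a P1 P2 0 0"
        using P by (simp_all add: ratio_1A_def ratio_1B_def ratio_1C_def max_absorb1 min_absorb1)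
    qed
    show ?thesis
      unfolding noiseberg_region_def mem_Collect_eq prod.case
    proof (intro conjI \<open>0 \<le> R1\<close> \<open>0 \<le> R2\<close>, rule exI[of _ 0], rule exI[of _ 0], rule conjI,
        goal_cases)
      case 1
      then show ?case using r P by (simp add: noiseberg_admissible_def power_1A_def)
    next
      case 2
      show ?case
        by (rule exI[of _ R1], rule exI[of _ R2], rule exI[of _ 0])
          (use \<open>0 \<le> R1\<close> \<open>0 \<le> R2\<close> b1 b2 r c in simp)
    qed
  next
    case False
    have "0 < ln (W / (W - P2))" using Wpos P by (intro ln_gt_zero) (simp add: field_simps)
    then have Rpos: "0 < R" using False by simp
    \<comment> \<open>Since \<open>u i \<ge> 1\<close>, removing the interference only helps user 2;
      Jensen then yields \<open>lo\<close>.\<close>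
    have "R \<le> (\<Sum>i=1..q. l i * (ln (v i) - ln (u i)))" using R2l by (simp add: R_def)
    also have "\<dots> \<le> (\<Sum>i=1..q. l i * ln (1 + p2 i))"
    proof (intro sum_mono mult_left_mono)
      fix i assume i: "i \<in> {1..q}"
      have "v i \<le> u i * (1 + p2 i)" using uvw[OF i] nn[OF i] mult_right_mono[of 1 "u i" "p2 i"]
        by (simp add: v_def algebra_simps)
      then have "ln (v i) \<le> ln (u i * (1 + p2 i))" using uvw[OF i] nn[OF i]
        by (subst ln_le_cancel_iff) (auto intro!: mult_pos_pos add_pos_nonneg)
      then show "ln (v i) - ln (u i) \<le> ln (1 + p2 i)"
        using uvw[OF i] nn[OF i] by (subst (asm) ln_mult) auto
    qed (use nn in auto)
    also have "\<dots> \<le> ln (1 + P2)" using nn l1 s2 P by (intro sum_ln_le_ln_mean) auto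
    finally have "exp R \<le> 1 + P2" using P by (simp add: ln_ge_iff)
    then have lo: "exp R - 1 \<le> P2" by simp
    have "exp (ln (W / (W - P2))) < exp R" using False by simp
    then have "W / (W - P2) < exp R" using Wpos by simp
    then have hi: "P2 * exp R < W * (exp R - 1)" using Wpos by (simp add: field_simps)
    obtain k u0 v0 wA wB \<nu> \<beta> \<gamma> where
      k: "1 \<le> k" and u0: "1 \<le> u0" and v0: "v0 = u0 + P2 * k" and lnvu: "ln v0 - ln u0 = k * R" and
      w: "v0 \<le> wA" "wA \<le> wB" "wB \<le> wA + \<delta>" "wA = v0 \<or> wB = wA + \<delta>" and
      W: "wA + (k - 1) * wB = k * W" and mult: "0 \<le> \<nu>" "0 \<le> \<beta>" "0 < \<gamma>" and
      max: "\<And>u' v' w'. 1 \<le> u' \<Longrightarrow> u' \<le> v' \<Longrightarrow> v' \<le> w' \<Longrightarrow>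
         lagr \<delta> \<nu> \<beta> \<gamma> u' v' w' \<le> lagr \<delta> \<nu> \<beta> \<gamma> u0 v0 wA" and
      eq: "k = 1 \<or> lagr \<delta> \<nu> \<beta> \<gamma> wB wB wB = lagr \<delta> \<nu> \<beta> \<gamma> u0 v0 wA"
      by (rule optimal_pair_exists[OF d P(2) Rpos lo hi]) blast
    define LA where "LA = lagr \<delta> \<nu> \<beta> \<gamma> u0 v0 wA"
    define S where "S = (\<Sum>i=1..q. l i * (ln (w i) + ln (u i - \<delta>) - ln (u i)))"
    define S2 where "S2 = (\<Sum>i=1..q. l i * (ln (v i) - ln (u i)))"
    define Z where "Z = (\<Sum>i=1..q. l i * (v i - u i))"
    define Y where "Y = (\<Sum>i=1..q. l i * w i)"
    have "S + \<nu> * S2 - \<beta> * Z - \<gamma> * Y = (\<Sum>i=1..q. l i * lagr \<delta> \<nu> \<beta> \<gamma> (u i) (v i) (w i))"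
      unfolding S_def S2_def Z_def Y_def sum_distrib_left sum.distrib[symmetric] sum_subtractf[symmetric]
      by (intro sum.cong) (auto simp: lagr_def algebra_simps)
    also have "\<dots> \<le> (\<Sum>i=1..q. l i * LA)"
      unfolding LA_def using nn uvw by (intro sum_mono mult_left_mono max) auto
    also have "\<dots> = LA" using l1 by (simp add: sum_distrib_right[symmetric])
    finally have 1: "S + \<nu> * S2 - \<beta> * Z - \<gamma> * Y \<le> LA" .
    have "\<nu> * R \<le> \<nu> * S2" "\<beta> * Z \<le> \<beta> * P2" "\<gamma> * Y \<le> \<gamma> * W"
      using mult R2l costz costw by (auto intro!: mult_left_mono simp: R_def S2_def Z_def Y_def)
    with 1 have "S \<le> LA - \<nu> * R + \<beta> * P2 + \<gamma> * W" by linarith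
    \<comment> \<open>Of the \<open>k\<close> copies of \<open>LA\<close>, the tie turns
      \<open>k - 1\<close> into slot \<open>B\<close> (none for \<open>k = 1\<close>). The price
      terms cancel because the pair meets \<open>R\<close>, \<open>P2\<close> and \<open>W\<close>
      with equality.\<close>
    then have "k * S \<le> k * (LA - \<nu> * R + \<beta> * P2 + \<gamma> * W)" using k by (intro mult_left_mono) auto
    also have "\<dots> = LA + (k - 1) * LA - \<nu> * (k * R) + \<beta> * (P2 * k) + \<gamma> * (k * W)"
      by (simp add: algebra_simps)
    also have "(k - 1) * LA = (k - 1) * lagr \<delta> \<nu> \<beta> \<gamma> wB wB wB" using eq by (auto simp: LA_def)
    also have "LA + (k - 1) * lagr \<delta> \<nu> \<beta> \<gamma> wB wB wB - \<nu> * (k * R) + \<beta> * (P2 * k) + \<gamma> * (k * W)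
      = ln wA + ln (u0 - \<delta>) - ln u0 + (k - 1) * ln (wB - \<delta>)"
      unfolding W[symmetric] lnvu[symmetric] LA_def lagr_def v0 by (simp add: algebra_simps)
    finally have kS: "k * S \<le> ln wA + ln (u0 - \<delta>) - ln u0 + (k - 1) * ln (wB - \<delta>)" .
    show ?thesis
    proof (rule noiseberg_regionI[OF a P c \<open>0 \<le> R1\<close> \<open>0 \<le> R2\<close> k u0 v0, folded \<delta>_def,
          OF w W[unfolded W_def]])
      show "2 * R2 * ln c * k = ln v0 - ln u0" using lnvu by (simp add: R_def)
      have "k * (2 * (R1 + R2) * ln c) \<le> k * (S - ln (a\<^sup>2))"
        using R12l k by (intro mult_left_mono) (auto simp: S_def)
      then show "2 * (R1 + R2) * ln c * k
        \<le> ln wA + ln (u0 - \<delta>) - ln u0 + (k - 1) * ln (wB - \<delta>) - k * ln (a\<^sup>2)"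
        using kS by (simp add: right_diff_distrib mult_ac)
    qed
  qed
qed

theorem corollary1:
  fixes a b P1 P2 c :: real
  assumes "0 < a" and "a \<le> 1"
    and "1 \<le> b" and "a * b > 1"
    and "0 < P1" and "0 < P2"
    and "1 < c"
  shows "noiseberg_region c a P1 P2 = mixed_HK_region c a P1 P2"
  using noiseberg_subset_HK HK_subset_noiseberg assms by blast

end
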